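(* Let $(A_j)_{j\ge1}$ be a sequence of non-negative real random variables and $B$ a non-negative real random variable with $\mathbb{P}(B=0)<1$. Let $((A_{t,j})_{j\ge1},B_t)_{t\in\mathbb{Z}}$ be a family of non-negative random variables satisfying either (A1) or (A2) (see context), and let $(X_t)_{t\ge0}$ be defined by $$X_t=\sum_{j=1}^\infty A_{t,j}X_{t-j}+B_t\quad(t\ge0),\qquad X_{-1}=X_{-2}=\cdots=0 .$$ For $\theta>0$ put $$\phi_1(\theta)=\log\sum_{j=1}^\infty\mathbb{E}[A_j^\theta],\qquad \tilde\phi_1(\theta)=\log\sum_{j=1}^\infty\mathbb{E}[A_j^\theta]^{1/\theta}.$$ Then: 1. As $t\to\infty$, $X_t$ converges in law to a (possibly infinite) limit $X$, i.e. a random variable $X$ with values in $[0,\infty]$. 2. If $\phi_1(\theta)<0$ and $\mathbb{E}[B^\theta]<\infty$ for some $\theta\in(0,1]$, then $\mathbb{E}[X^\theta]<\infty$. 3. If $\phi_1(\theta)\ge0$ or $\mathbb{E}[B^\theta]=\infty$ for some $\theta\ge1$, then $\mathbb{E}[X^\theta]=\infty$. 4. If $\tilde\phi_1(\theta)<0$ and $\mathbb{E}[B^\theta]<\infty$ for some $\theta\ge1$, then $\mathbb{E}[X^\theta]<\infty$. 5. If $\tilde\phi_1(\theta)\ge0$ or $\mathbb{E}[B^\theta]=\infty$ for some $0<\theta<1$, then $\mathbb{E}[X^\theta]=\infty$.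
   Context: Arbitrary dependencies among the random variables $(A_j)_{j\ge1}$ and $B$ are allowed, except that $B$ is independent of $(A_j)_{j\ge1}$ under (A2). (A1): $((A_{t,j})_{j\ge1},B_t)_{t\in\mathbb{Z}}$ are i.i.d. (over $t$) copies of the random sequence $((A_j)_{j\ge1},B)$. (A2): $((A_{t+j,j})_{j\ge1})_{t\in\mathbb{Z}}$ are i.i.d. (over $t$) copies of the random sequence $(A_j)_{j\ge1}$; moreover $B$ is independent of $(A_j)_{j\ge1}$, that is, $(B_t)_{t\in\mathbb{Z}}$ are i.i.d. copies of $B$, and the family $(B_t)_{t\in\mathbb{Z}}$ is independent of the family $(A_{t,j})_{t\in\mathbb{Z},j\ge1}$. Conventions: expectations of non-negative random variables and sums of non-negative terms take values in $[0,\infty]$; $\infty^{r}=\infty$ for $r>0$; $\log 0=-\infty$, $\log\infty=+\infty$. *)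

theory Defs
  imports "HOL-Probability.Probability"
begin

text \<open>Power and logarithm on \<open>[0,\<infinity>]\<close>; \<open>ennreal_powr\<close> is only meant for exponents \<open>r > 0\<close>.\<close>

definition ennreal_powr :: "ennreal \<Rightarrow> real \<Rightarrow> ennreal" where
  "ennreal_powr x r = (if x = \<infinity> then \<infinity> else ennreal (enn2real x powr r))"

definition ennreal_ln :: "ennreal \<Rightarrow> ereal" where
  "ennreal_ln x = (if x = 0 then - \<infinity> else if x = \<infinity> then \<infinity> else ereal (ln (enn2real x)))"

definition moment :: "'a measure \<Rightarrow> ('a \<Rightarrow> ennreal) \<Rightarrow> real \<Rightarrow> ennreal" where
  "moment M Y \<theta> = (\<integral>\<^sup>+\<omega>. ennreal_powr (Y \<omega>) \<theta> \<partial>M)"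

text \<open>Sequences \<open>(A\<^sub>j)\<close> are indexed by \<open>j \<ge> 1\<close>: the value of \<open>A\<close> at index 0 is never used, and
  the series over \<open>j \<ge> 1\<close> are written as series over \<open>Suc j\<close>.\<close>

definition phi1 :: "'a measure \<Rightarrow> (nat \<Rightarrow> 'a \<Rightarrow> real) \<Rightarrow> real \<Rightarrow> ereal" where
  "phi1 M A \<theta> = ennreal_ln (\<Sum>j. moment M (\<lambda>\<omega>. ennreal (A (Suc j) \<omega>)) \<theta>)"

definition phi1_tilde :: "'a measure \<Rightarrow> (nat \<Rightarrow> 'a \<Rightarrow> real) \<Rightarrow> real \<Rightarrow> ereal" where
  "phi1_tilde M A \<theta> =
    ennreal_ln (\<Sum>j. ennreal_powr (moment M (\<lambda>\<omega>. ennreal (A (Suc j) \<omega>)) \<theta>) (1 / \<theta>))"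

text \<open>Weak convergence of the laws on the compact space \<open>[0,\<infinity>]\<close>, where mass may escape to the
  point \<open>\<infinity>\<close>. The library's \<open>weak_conv_m\<close> covers only laws on the real line.\<close>

definition converges_in_law ::
  "'a measure \<Rightarrow> (nat \<Rightarrow> 'a \<Rightarrow> ennreal) \<Rightarrow> 'b measure \<Rightarrow> ('b \<Rightarrow> ennreal) \<Rightarrow> bool" where
  "converges_in_law M Y N Z \<longleftrightarrow>
    (\<forall>f :: ennreal \<Rightarrow> real. continuous_on UNIV f \<longrightarrow> bounded (range f) \<longrightarrow>
       (\<lambda>n. \<integral>\<omega>. f (Y n \<omega>) \<partial>M) \<longlonglongrightarrow> (\<integral>\<omega>. f (Z \<omega>) \<partial>N))"

text \<open>Independence of two random elements with values in possibly different types
  (\<open>indep_var\<close> requires both to have the same type).\<close>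

definition indep_elements ::
  "'a measure \<Rightarrow> 'b measure \<Rightarrow> ('a \<Rightarrow> 'b) \<Rightarrow> 'c measure \<Rightarrow> ('a \<Rightarrow> 'c) \<Rightarrow> bool" where
  "indep_elements M S Y T Z \<longleftrightarrow> Y \<in> measurable M S \<and> Z \<in> measurable M T \<and>
    prob_space.indep_set M (sets (vimage_algebra (space M) Y S)) (sets (vimage_algebra (space M) Z T))"

definition iid_copies ::
  "'a measure \<Rightarrow> ('i \<Rightarrow> 'a \<Rightarrow> 'c) \<Rightarrow> 'c measure \<Rightarrow> 'b measure \<Rightarrow> ('b \<Rightarrow> 'c) \<Rightarrow> bool" where
  "iid_copies M Y S N Z \<longleftrightarrow> prob_space.indep_vars M (\<lambda>_. S) Y UNIV \<and>
    (\<forall>t. distr M S (Y t) = distr N S Z)"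

abbreviation seq_space :: "(nat \<Rightarrow> real) measure" where
  "seq_space \<equiv> Pi\<^sub>M {1..} (\<lambda>_. borel)"

definition cond_A1 :: "'a measure \<Rightarrow> (nat \<Rightarrow> 'a \<Rightarrow> real) \<Rightarrow> ('a \<Rightarrow> real) \<Rightarrow>
    'b measure \<Rightarrow> (int \<Rightarrow> nat \<Rightarrow> 'b \<Rightarrow> real) \<Rightarrow> (int \<Rightarrow> 'b \<Rightarrow> real) \<Rightarrow> bool" where
  "cond_A1 M0 A B M At Bt \<longleftrightarrow>
    iid_copies M (\<lambda>t \<omega>. (\<lambda>j\<in>{1..}. At t j \<omega>, Bt t \<omega>)) (seq_space \<Otimes>\<^sub>M borel)
      M0 (\<lambda>\<omega>. (\<lambda>j\<in>{1..}. A j \<omega>, B \<omega>))"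

definition cond_A2 :: "'a measure \<Rightarrow> (nat \<Rightarrow> 'a \<Rightarrow> real) \<Rightarrow> ('a \<Rightarrow> real) \<Rightarrow>
    'b measure \<Rightarrow> (int \<Rightarrow> nat \<Rightarrow> 'b \<Rightarrow> real) \<Rightarrow> (int \<Rightarrow> 'b \<Rightarrow> real) \<Rightarrow> bool" where
  "cond_A2 M0 A B M At Bt \<longleftrightarrow>
    iid_copies M (\<lambda>t \<omega>. \<lambda>j\<in>{1..}. At (t + int j) j \<omega>) seq_space M0 (\<lambda>\<omega>. \<lambda>j\<in>{1..}. A j \<omega>) \<and>
    indep_elements M0 borel B seq_space (\<lambda>\<omega>. \<lambda>j\<in>{1..}. A j \<omega>) \<and>
    iid_copies M Bt borel M0 B \<and>
    indep_elements M (Pi\<^sub>M UNIV (\<lambda>_. borel)) (\<lambda>\<omega> t. Bt t \<omega>)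
      (Pi\<^sub>M (UNIV \<times> {1..}) (\<lambda>_. borel)) (\<lambda>\<omega>. \<lambda>(t, j)\<in>UNIV \<times> {1..}. At t j \<omega>)"

end

theory Submission
  imports Defs
begin

text \<open>
  Started at time \<open>-n\<close> instead of \<open>0\<close>, the recursion yields at time \<open>0\<close> a variable with the law of
  \<open>X\<^sub>n\<close>, by stationarity of the coefficients, and this variable increases with \<open>n\<close>. Hence \<open>X\<^sub>n\<close>
  converges in law and \<open>E X\<^sup>\<theta>\<close> is the supremum \<open>m\<close> of the increasing sequence \<open>m\<^sub>n = E X\<^sub>n\<^sup>\<theta>\<close>.

  Under both independence assumptions \<open>A\<^bsub>t,j\<^esub>\<close> is independent of \<open>X\<^bsub>t-j\<^esub>\<close>, so the summands
  of \<open>X\<^sub>n\<close> have \<open>\<theta>\<close>-th moments \<open>a\<^sub>j m\<^bsub>n-j\<^esub>\<close> with \<open>a\<^sub>j = E A\<^sub>j\<^sup>\<theta>\<close>. Sub- and superadditivity of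
  \<open>x\<^sup>\<theta>\<close> compare \<open>m\<close> with \<open>(\<Sum>j. a\<^sub>j) m + E B\<^sup>\<theta>\<close>. For the criteria with \<open>a\<^sub>j\<^bsup>1/\<theta>\<^esup>\<close>,
  Minkowski's inequality is replaced by the comparison of \<open>(\<Sum>i. x\<^sub>i)\<^sup>\<theta>\<close> with
  \<open>\<Sum>i. w\<^sub>i\<^bsup>1-\<theta>\<^esup> x\<^sub>i\<^sup>\<theta>\<close>, valid for all weights \<open>w\<close> of total mass at most 1, with weights
  proportional to \<open>a\<^sub>j\<^bsup>1/\<theta>\<^esup>\<close>.
\<close>

section \<open>Power sums\<close>

text \<open>After division by the total \<open>S\<close>, every summand lies in [0,1], where raising
  to a power \<theta> \<ge> 1 can only decrease it; the normalized summands add up to 1.\<close>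

lemma sum_powr_le_powr_sum:
  fixes x :: "'i \<Rightarrow> real"
  assumes "finite I" "\<And>i. i \<in> I \<Longrightarrow> 0 \<le> x i" "1 \<le> \<theta>"
  shows "(\<Sum>i\<in>I. x i powr \<theta>) \<le> (\<Sum>i\<in>I. x i) powr \<theta>"
proof (cases "(\<Sum>i\<in>I. x i) = 0")
  case True
  with assms show ?thesis by (simp add: sum_nonneg_eq_0_iff)
next
  case False
  define S where "S = (\<Sum>i\<in>I. x i)"
  have S: "S > 0" using False assms by (simp add: S_def sum_nonneg less_le)
  have "x i powr \<theta> \<le> S powr \<theta> * (x i / S)" if "i \<in> I" for i
  proof -
    have le: "x i \<le> S" unfolding S_def using assms that by (intro member_le_sum) auto
    have "(x i / S) powr \<theta> \<le> (x i / S) powr 1"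
      using assms that S le by (intro powr_mono') auto
    with assms(2)[OF that] S show ?thesis by (simp add: powr_divide field_simps)
  qed
  then have "(\<Sum>i\<in>I. x i powr \<theta>) \<le> (\<Sum>i\<in>I. S powr \<theta> * (x i / S))" by (rule sum_mono)
  also have "\<dots> = S powr \<theta>"
    using S by (simp add: S_def flip: sum_distrib_left sum_divide_distrib)
  finally show ?thesis by (simp add: S_def)
qed

text \<open>This is superadditivity for the exponent 1/\<theta> \<ge> 1, applied to the numbers
  \<open>x i powr \<theta>\<close>.\<close>

lemma powr_sum_le_sum_powr:
  fixes x :: "'i \<Rightarrow> real"
  assumes "finite I" "\<And>i. i \<in> I \<Longrightarrow> 0 \<le> x i" "0 < \<theta>" "\<theta> \<le> 1"
  shows "(\<Sum>i\<in>I. x i) powr \<theta> \<le> (\<Sum>i\<in>I. x i powr \<theta>)"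
proof -
  have "(\<Sum>i\<in>I. (x i powr \<theta>) powr (1/\<theta>)) \<le> (\<Sum>i\<in>I. x i powr \<theta>) powr (1/\<theta>)"
    using assms by (intro sum_powr_le_powr_sum) auto
  then have "(\<Sum>i\<in>I. x i) \<le> (\<Sum>i\<in>I. x i powr \<theta>) powr (1/\<theta>)"
    using assms by (simp add: powr_powr)
  then have "(\<Sum>i\<in>I. x i) powr \<theta> \<le> ((\<Sum>i\<in>I. x i powr \<theta>) powr (1/\<theta>)) powr \<theta>"
    using assms by (intro powr_mono2 sum_nonneg) auto
  with assms show ?thesis by (simp add: powr_powr sum_nonneg)
qed

text \<open>A form of Hoelder's inequality. Young's inequality bounds each normalized term by the
  convex combination of \<open>x i / S\<close> and \<open>w i\<close> with weights \<theta> and 1 -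
  \<theta>; summation then uses that both families have total mass at most 1.\<close>

lemma weighted_sum_powr_le_powr_sum:
  fixes x w :: "'i \<Rightarrow> real"
  assumes I: "finite I" and x: "\<And>i. i \<in> I \<Longrightarrow> 0 \<le> x i" and w: "\<And>i. i \<in> I \<Longrightarrow> 0 \<le> w i"
    and wsum: "(\<Sum>i\<in>I. w i) \<le> 1" and \<theta>: "0 < \<theta>" "\<theta> \<le> 1"
  shows "(\<Sum>i\<in>I. w i powr (1 - \<theta>) * x i powr \<theta>) \<le> (\<Sum>i\<in>I. x i) powr \<theta>"
proof (cases "(\<Sum>i\<in>I. x i) = 0")
  case True
  with assms show ?thesis by (simp add: sum_nonneg_eq_0_iff)
next
  case False
  define S where "S = (\<Sum>i\<in>I. x i)"
  have S: "S > 0" using False assms by (simp add: S_def sum_nonneg less_le)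
  have "w i powr (1 - \<theta>) * x i powr \<theta> \<le> S powr \<theta> * (\<theta> * (x i / S) + (1 - \<theta>) * w i)"
    if "i \<in> I" for i
  proof -
    \<comment> \<open>If \<open>x i\<close> or \<open>w i\<close> vanishes, the left side is 0,
      because \<open>0 powr r = 0\<close> for every \<open>r\<close>; otherwise this is Young's
      inequality.\<close>
    have "(x i / S) powr \<theta> * w i powr (1 - \<theta>) \<le> \<theta> * (x i / S) + (1 - \<theta>) * w i"
      using x[OF that] w[OF that] S \<theta> Youngs_inequality_0[of \<theta> "1 - \<theta>" "x i / S" "w i"]
      by (cases "x i = 0 \<or> w i = 0") auto
    with x[OF that] S show ?thesis by (simp add: powr_divide field_simps)
  qed
  then have "(\<Sum>i\<in>I. w i powr (1 - \<theta>) * x i powr \<theta>)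
      \<le> (\<Sum>i\<in>I. S powr \<theta> * (\<theta> * (x i / S) + (1 - \<theta>) * w i))" by (rule sum_mono)
  also have "\<dots> = S powr \<theta> * (\<theta> + (1 - \<theta>) * (\<Sum>i\<in>I. w i))"
    using S by (simp add: S_def sum.distrib flip: sum_distrib_left sum_divide_distrib)
  also have "\<dots> \<le> S powr \<theta> * 1"
    using \<theta> mult_left_mono[OF wsum, of "1 - \<theta>"] by (intro mult_left_mono) auto
  finally show ?thesis by (simp add: S_def)
qed

text \<open>Dual to the preceding inequality: that one, with exponent 1/\<theta>, is applied to the
  weighted powers \<open>y i\<close>, from which \<open>x i\<close> is recovered. The condition
  \<open>null\<close> reflects the convention \<open>0 powr r = 0\<close>: a term of weight 0
  disappears on the right although its exponent 1 - \<theta> is not positive.\<close>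

lemma powr_sum_le_weighted_sum_powr:
  fixes x w :: "'i \<Rightarrow> real"
  assumes I: "finite I" and x: "\<And>i. i \<in> I \<Longrightarrow> 0 \<le> x i" and w: "\<And>i. i \<in> I \<Longrightarrow> 0 \<le> w i"
    and wsum: "(\<Sum>i\<in>I. w i) \<le> 1" and \<theta>: "1 \<le> \<theta>"
    and null: "\<And>i. i \<in> I \<Longrightarrow> w i = 0 \<Longrightarrow> x i = 0"
  shows "(\<Sum>i\<in>I. x i) powr \<theta> \<le> (\<Sum>i\<in>I. w i powr (1 - \<theta>) * x i powr \<theta>)"
proof -
  define y where "y i = w i powr (1 - \<theta>) * x i powr \<theta>" for i
  have "w i powr (1 - 1 / \<theta>) * y i powr (1 / \<theta>) = x i" if "i \<in> I" for i
  proof (cases "w i = 0")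
    case False
    then have "w i > 0" using w[OF that] by simp
    moreover have "(1 - \<theta>) / \<theta> = - (1 - 1 / \<theta>)" using \<theta> by (simp add: field_simps)
    ultimately show ?thesis using x[OF that] \<theta>
      by (simp add: y_def powr_mult powr_powr flip: powr_add mult.assoc)
  qed (use null that in simp)
  then have "(\<Sum>i\<in>I. x i) = (\<Sum>i\<in>I. w i powr (1 - 1 / \<theta>) * y i powr (1 / \<theta>))" by simp
  also have "\<dots> \<le> (\<Sum>i\<in>I. y i) powr (1 / \<theta>)"
    using assms by (intro weighted_sum_powr_le_powr_sum) (auto simp: y_def)
  finally have "(\<Sum>i\<in>I. x i) powr \<theta> \<le> ((\<Sum>i\<in>I. y i) powr (1 / \<theta>)) powr \<theta>"
    using \<theta> x by (intro powr_mono2 sum_nonneg) auto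
  then show ?thesis using \<theta> by (simp add: powr_powr y_def sum_nonneg)
qed

section \<open>Moments of a linear recursion\<close>

lemma ennreal_powr_ennreal: "0 \<le> x \<Longrightarrow> ennreal_powr (ennreal x) r = ennreal (x powr r)"
  by (simp add: ennreal_powr_def)

lemma ennreal_ln_neg_iff: "ennreal_ln x < 0 \<longleftrightarrow> x < 1"
proof (cases x)
  case (real r)
  then show ?thesis
    by (cases "r = 0") (auto simp: ennreal_ln_def zero_ereal_def ennreal_less_one_iff)
qed (auto simp: ennreal_ln_def zero_ereal_def)

lemma ennreal_ln_nonneg_iff: "0 \<le> ennreal_ln x \<longleftrightarrow> 1 \<le> x"
  using ennreal_ln_neg_iff[of x] by (meson not_less)

text \<open>The abstract setting of all moment bounds. \<open>P n j\<close> stands for the product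
  of the coefficient of lag j + 1 with the solution at time n - (j + 1), and enters only through its
  \<theta>-th moment. The dependence between the summands of \<open>Y n\<close> is left
  arbitrary.\<close>

locale moment_recursion = prob_space M for M :: "'b measure" +
  fixes P :: "nat \<Rightarrow> nat \<Rightarrow> 'b \<Rightarrow> real" and Bt Y :: "nat \<Rightarrow> 'b \<Rightarrow> real"
    and \<theta> :: real and a :: "nat \<Rightarrow> ennreal" and \<beta> :: ennreal and m :: "nat \<Rightarrow> ennreal"
  assumes measurable_P [measurable]: "\<And>n j. P n j \<in> borel_measurable M"
    and measurable_B [measurable]: "\<And>n. Bt n \<in> borel_measurable M"
    and P_nonneg: "\<And>n j \<omega>. \<omega> \<in> space M \<Longrightarrow> 0 \<le> P n j \<omega>"
    and B_nonneg: "\<And>n \<omega>. \<omega> \<in> space M \<Longrightarrow> 0 \<le> Bt n \<omega>"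
    and Y_rec: "\<And>n \<omega>. \<omega> \<in> space M \<Longrightarrow> Y n \<omega> = (\<Sum>j<n. P n j \<omega>) + Bt n \<omega>"
    and P_moment: "\<And>n j. j < n \<Longrightarrow> (\<integral>\<^sup>+\<omega>. ennreal (P n j \<omega> powr \<theta>) \<partial>M) = a j * m (n - Suc j)"
    and B_moment: "\<And>n. (\<integral>\<^sup>+\<omega>. ennreal (Bt n \<omega> powr \<theta>) \<partial>M) = \<beta>"
    and m_def: "\<And>n. m n = (\<integral>\<^sup>+\<omega>. ennreal (Y n \<omega> powr \<theta>) \<partial>M)"
    and m_mono: "incseq m"
    and \<theta>_pos: "0 < \<theta>" and \<beta>_pos: "0 < \<beta>"
begin

text \<open>Integrates the weighted power sums that are compared with
  \<open>Y n \<omega> powr \<theta>\<close>; the weight \<open>w n\<close>, one past the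
  coefficients, belongs to the inhomogeneous term.\<close>

lemma nn_integral_weighted:
  fixes w :: "nat \<Rightarrow> real"
  assumes w: "\<And>j. 0 \<le> w j"
  shows "(\<integral>\<^sup>+\<omega>. ennreal ((\<Sum>j<n. w j * P n j \<omega> powr \<theta>) + w n * Bt n \<omega> powr \<theta>) \<partial>M)
    = (\<Sum>j<n. ennreal (w j) * a j * m (n - Suc j)) + ennreal (w n) * \<beta>"
proof -
  have "(\<integral>\<^sup>+\<omega>. ennreal ((\<Sum>j<n. w j * P n j \<omega> powr \<theta>) + w n * Bt n \<omega> powr \<theta>) \<partial>M)
    = (\<integral>\<^sup>+\<omega>. (\<Sum>j<n. ennreal (w j) * ennreal (P n j \<omega> powr \<theta>))
          + ennreal (w n) * ennreal (Bt n \<omega> powr \<theta>) \<partial>M)"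
    using w by (simp add: ennreal_plus sum_nonneg ennreal_mult flip: sum_ennreal)
  also have "\<dots> = (\<Sum>j<n. ennreal (w j) * (\<integral>\<^sup>+\<omega>. ennreal (P n j \<omega> powr \<theta>) \<partial>M))
      + ennreal (w n) * (\<integral>\<^sup>+\<omega>. ennreal (Bt n \<omega> powr \<theta>) \<partial>M)"
    by (simp add: nn_integral_add nn_integral_sum nn_integral_cmult)
  finally show ?thesis by (simp add: P_moment B_moment mult.assoc)
qed

text \<open>Treats the inhomogeneous term as the summand of index \<open>n\<close>, so that the
  inequalities for a single finite sum apply.\<close>

lemma Y_eq_sum:
  "\<omega> \<in> space M \<Longrightarrow> Y n \<omega> = (\<Sum>j\<in>{..<Suc n}. if j < n then P n j \<omega> else Bt n \<omega>)"
  by (simp add: Y_rec)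

section \<open>Upper bounds: finite moments\<close>

text \<open>The constant \<open>C\<close> is the fixed point of x \<mapsto> \<rho> x + g, where
  \<rho> < 1 is the sum of the \<open>b j\<close>; the bound \<open>m n \<le> C\<close> therefore
  propagates by strong induction.\<close>

lemma SUP_m_finite:
  assumes step: "\<And>n. m n \<le> (\<Sum>j<n. b j * m (n - Suc j)) + \<gamma>"
    and sum: "(\<Sum>j. b j) < 1" and \<gamma>: "\<gamma> < \<infinity>"
  shows "(SUP n. m n) < \<infinity>"
proof -
  obtain \<rho> where \<rho>: "(\<Sum>j. b j) = ennreal \<rho>" "0 \<le> \<rho>" using sum by (cases "\<Sum>j. b j") auto
  with sum have \<rho>1: "\<rho> < 1" by (simp add: ennreal_less_one_iff)
  obtain g where g: "\<gamma> = ennreal g" "0 \<le> g" using \<gamma> by (cases \<gamma>) auto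
  define C where "C = g / (1 - \<rho>)"
  have C: "0 \<le> C" "\<rho> * C + g = C" using g \<rho>1 by (auto simp: C_def field_simps)
  have "m n \<le> ennreal C" for n
  proof (induction n rule: less_induct)
    case (less n)
    have "m n \<le> (\<Sum>j<n. b j * m (n - Suc j)) + \<gamma>" by (rule step)
    also have "(\<Sum>j<n. b j * m (n - Suc j)) \<le> (\<Sum>j<n. b j * ennreal C)"
      by (intro sum_mono mult_left_mono less) auto
    also have "\<dots> \<le> (\<Sum>j. b j) * ennreal C"
      by (simp add: sum_le_suminf mult_right_mono flip: sum_distrib_right)
    also have "\<dots> + \<gamma> = ennreal (\<rho> * C + g)"
      unfolding \<rho>(1) g(1) using \<rho>(2) g(2) C(1) by (metis ennreal_mult ennreal_plus mult_nonneg_nonneg)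
    finally show ?case by (simp add: C)
  qed
  then have "(SUP n. m n) \<le> ennreal C" by (rule SUP_least)
  then show ?thesis by (metis ennreal_less_top infinity_ennreal_def le_less_trans)
qed

text \<open>Subadditivity of the power turns the recursion for \<open>Y\<close> into one for the
  moments, with coefficients \<open>a j\<close> and constant term \<beta>.\<close>

lemma SUP_m_finite_le_1:
  assumes "\<theta> \<le> 1" "(\<Sum>j. a j) < 1" "\<beta> < \<infinity>"
  shows "(SUP n. m n) < \<infinity>"
proof (rule SUP_m_finite[OF _ assms(2,3)])
  fix n
  have "m n \<le> (\<integral>\<^sup>+\<omega>. ennreal ((\<Sum>j<n. 1 * P n j \<omega> powr \<theta>) + 1 * Bt n \<omega> powr \<theta>) \<partial>M)"
    unfolding m_def
  proof (intro nn_integral_mono ennreal_leI)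
    fix \<omega> assume \<omega>: "\<omega> \<in> space M"
    have "Y n \<omega> powr \<theta> \<le> (\<Sum>j\<in>{..<Suc n}. (if j < n then P n j \<omega> else Bt n \<omega>) powr \<theta>)"
      unfolding Y_eq_sum[OF \<omega>] using \<omega> P_nonneg B_nonneg \<theta>_pos assms
      by (intro powr_sum_le_sum_powr) auto
    then show "Y n \<omega> powr \<theta> \<le> (\<Sum>j<n. 1 * P n j \<omega> powr \<theta>) + 1 * Bt n \<omega> powr \<theta>" by simp
  qed
  then show "m n \<le> (\<Sum>j<n. a j * m (n - Suc j)) + \<beta>"
    using nn_integral_weighted[of "\<lambda>_. 1" n] by simp
qed

text \<open>The weighted inequality is used with weight \<open>\<alpha> j\<close>, the root of
  \<open>a j\<close>, on each coefficient and the remaining mass 1 - \<rho> on the noise. The moment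
  recursion then has coefficients \<open>\<alpha> j\<close>, whose sum is below 1.\<close>

lemma SUP_m_finite_ge_1:
  assumes \<theta>: "1 \<le> \<theta>" and sum: "(\<Sum>j. ennreal_powr (a j) (1 / \<theta>)) < 1" and \<beta>: "\<beta> < \<infinity>"
  shows "(SUP n. m n) < \<infinity>"
proof -
  define \<alpha> where "\<alpha> j = enn2real (a j) powr (1 / \<theta>)" for j
  have afin: "a j < \<infinity>" for j
  proof -
    have "ennreal_powr (a j) (1 / \<theta>) < 1" using ennreal_suminf_lessD[OF sum] .
    then show ?thesis by (auto simp: ennreal_powr_def less_top split: if_splits)
  qed
  have \<alpha>: "ennreal_powr (a j) (1 / \<theta>) = ennreal (\<alpha> j)" "0 \<le> \<alpha> j" for j
    using afin[of j] by (auto simp: \<alpha>_def ennreal_powr_def)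
  have a_eq: "a j = ennreal (\<alpha> j powr \<theta>)" for j
    using afin[of j] \<theta> by (simp add: \<alpha>_def powr_powr less_top)
  have sum': "(\<Sum>j. ennreal (\<alpha> j)) < 1" using sum by (simp add: \<alpha>)
  obtain \<rho> where \<rho>: "(\<Sum>j. ennreal (\<alpha> j)) = ennreal \<rho>" "0 \<le> \<rho>"
    using sum' by (cases "\<Sum>j. ennreal (\<alpha> j)") auto
  with sum' have \<rho>1: "\<rho> < 1" by (simp add: ennreal_less_one_iff)
  have \<alpha>sum: "(\<Sum>j<n. \<alpha> j) \<le> \<rho>" for n
  proof -
    have "ennreal (\<Sum>j<n. \<alpha> j) \<le> ennreal \<rho>"
      unfolding \<rho>(1)[symmetric] sum_ennreal[OF \<alpha>(2), symmetric] by (rule sum_le_suminf) auto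
    then show ?thesis using \<rho> by simp
  qed
  show ?thesis
  proof (rule SUP_m_finite[OF _ sum'])
    show "ennreal ((1 - \<rho>) powr (1 - \<theta>)) * \<beta> < \<infinity>" using \<beta> by (simp add: ennreal_mult_less_top)
    fix n
    define w where "w j = (if j < n then \<alpha> j else 1 - \<rho>)" for j
    have w: "0 \<le> w j" for j using \<alpha> \<rho>1 by (simp add: w_def)
    \<comment> \<open>If \<open>\<alpha> j = 0\<close> then \<open>a j = 0\<close>, so the summand
      \<open>P n j\<close> vanishes almost surely. This provides the null condition of the weighted
      inequality, which thus holds almost everywhere.\<close>
    have null: "AE \<omega> in M. \<forall>j\<in>{..<n}. \<alpha> j = 0 \<longrightarrow> P n j \<omega> = 0"
    proof (subst AE_ball_countable, simp, intro ballI)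
      fix j assume j: "j \<in> {..<n}"
      show "AE \<omega> in M. \<alpha> j = 0 \<longrightarrow> P n j \<omega> = 0"
      proof (cases "\<alpha> j = 0")
        case True
        then have "(\<integral>\<^sup>+\<omega>. ennreal (P n j \<omega> powr \<theta>) \<partial>M) = 0"
          using j by (simp add: P_moment a_eq)
        then show ?thesis using P_nonneg by (simp add: nn_integral_0_iff_AE)
      qed simp
    qed
    have "m n \<le> (\<integral>\<^sup>+\<omega>. ennreal ((\<Sum>j<n. w j powr (1 - \<theta>) * P n j \<omega> powr \<theta>)
        + w n powr (1 - \<theta>) * Bt n \<omega> powr \<theta>) \<partial>M)"
      unfolding m_def
    proof (rule nn_integral_mono_AE, use null AE_space in eventually_elim, rule ennreal_leI)
      fix \<omega> assume nl: "\<forall>j\<in>{..<n}. \<alpha> j = 0 \<longrightarrow> P n j \<omega> = 0" and \<omega>: "\<omega> \<in> space M"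
      have "Y n \<omega> powr \<theta> \<le> (\<Sum>j\<in>{..<Suc n}. w j powr (1 - \<theta>) *
          (if j < n then P n j \<omega> else Bt n \<omega>) powr \<theta>)"
        unfolding Y_eq_sum[OF \<omega>]
        using \<omega> P_nonneg B_nonneg \<theta> w \<alpha>sum[of n] nl \<rho>1
        by (intro powr_sum_le_weighted_sum_powr) (auto simp: w_def split: if_splits)
      then show "Y n \<omega> powr \<theta> \<le> (\<Sum>j<n. w j powr (1 - \<theta>) * P n j \<omega> powr \<theta>)
          + w n powr (1 - \<theta>) * Bt n \<omega> powr \<theta>" by simp
    qed
    also have "\<dots> = (\<Sum>j<n. ennreal (w j powr (1 - \<theta>)) * a j * m (n - Suc j))
        + ennreal (w n powr (1 - \<theta>)) * \<beta>"
      by (rule nn_integral_weighted) simp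
    also have "(\<Sum>j<n. ennreal (w j powr (1 - \<theta>)) * a j * m (n - Suc j))
        = (\<Sum>j<n. ennreal (\<alpha> j) * m (n - Suc j))"
    proof (intro sum.cong refl, goal_cases)
      case (1 j)
      \<comment> \<open>This explains the choice of weights: the factor from the weight and
        \<open>a j\<close> combine to \<open>\<alpha> j\<close>, also when
        \<open>\<alpha> j = 0\<close>.\<close>
      have "\<alpha> j powr (1 - \<theta>) * \<alpha> j powr \<theta> = \<alpha> j"
        using \<alpha>(2)[of j] by (simp flip: powr_add)
      then show ?case using 1 by (simp add: w_def a_eq flip: ennreal_mult)
    qed
    finally show "m n \<le> (\<Sum>j<n. ennreal (\<alpha> j) * m (n - Suc j))
        + ennreal ((1 - \<rho>) powr (1 - \<theta>)) * \<beta>" by (simp add: w_def)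
  qed
qed

section \<open>Lower bounds: infinite moments\<close>

text \<open>With the number \<open>J\<close> of terms fixed, all the times n + J - (j + 1) are at
  least \<open>n\<close>. Monotonicity of \<open>m\<close> replaces each of these moments by
  \<open>m n\<close>, and the supremum over \<open>n\<close> can then be taken.\<close>

lemma SUP_m_ge:
  assumes step: "\<And>n. J \<le> n \<Longrightarrow> (\<Sum>j<J. b j * m (n - Suc j)) + \<gamma> \<le> m n"
  shows "(\<Sum>j<J. b j) * (SUP n. m n) + \<gamma> \<le> (SUP n. m n)"
proof -
  have "(\<Sum>j<J. b j) * (SUP n. m n) + \<gamma> = (SUP n. (\<Sum>j<J. b j) * m n + \<gamma>)"
    by (simp add: SUP_mult_left_ennreal ennreal_SUP_add_left)
  also have "\<dots> \<le> (SUP n. m n)"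
  proof (rule SUP_least)
    fix n
    have "(\<Sum>j<J. b j) * m n \<le> (\<Sum>j<J. b j * m (n + J - Suc j))"
      unfolding sum_distrib_right by (intro sum_mono mult_left_mono incseqD[OF m_mono]) auto
    then have "(\<Sum>j<J. b j) * m n + \<gamma> \<le> m (n + J)"
      using step[of "n + J"] by (meson add_right_mono le_add2 order_trans)
    also have "\<dots> \<le> (SUP n. m n)" by (rule SUP_upper) simp
    finally show "(\<Sum>j<J. b j) * m n + \<gamma> \<le> (SUP n. m n)" .
  qed
  finally show ?thesis .
qed

lemma m_0: "m 0 = \<beta>"
  unfolding m_def B_moment[of 0, symmetric] by (intro nn_integral_cong) (simp add: Y_rec)

lemma \<beta>_le_SUP_m: "\<beta> \<le> (SUP n. m n)"
  by (metis m_0 SUP_upper UNIV_I)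

text \<open>Let s be the supremum. Superadditivity gives (\<Sum>j. a j) s + \<beta> \<le> s. If s
  were finite and the series at least 1, this would contradict \<beta> > 0; an infinite \<beta> is
  excluded by \<beta> \<le> s.\<close>

lemma SUP_m_infinite_ge_1:
  assumes \<theta>: "1 \<le> \<theta>" and or: "1 \<le> (\<Sum>j. a j) \<or> \<beta> = \<infinity>"
  shows "(SUP n. m n) = \<infinity>"
proof (rule ccontr)
  assume neq: "(SUP n. m n) \<noteq> \<infinity>"
  then have "\<beta> \<noteq> \<infinity>" using \<beta>_le_SUP_m by (metis infinity_ennreal_def top_unique)
  with or have sum: "1 \<le> (\<Sum>j. a j)" by simp
  have step: "(\<Sum>j<J. a j * m (n - Suc j)) + \<beta> \<le> m n" if "J \<le> n" for J n
  proof -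
    have "(\<Sum>j<J. a j * m (n - Suc j)) + \<beta> \<le> (\<Sum>j<n. a j * m (n - Suc j)) + \<beta>"
      using that by (intro add_right_mono sum_mono2) auto
    also have "\<dots> = (\<integral>\<^sup>+\<omega>. ennreal ((\<Sum>j<n. 1 * P n j \<omega> powr \<theta>) + 1 * Bt n \<omega> powr \<theta>) \<partial>M)"
      using nn_integral_weighted[of "\<lambda>_. 1" n] by simp
    also have "\<dots> \<le> m n"
      unfolding m_def
    proof (intro nn_integral_mono ennreal_leI)
      fix \<omega> assume \<omega>: "\<omega> \<in> space M"
      have "(\<Sum>j\<in>{..<Suc n}. (if j < n then P n j \<omega> else Bt n \<omega>) powr \<theta>) \<le> Y n \<omega> powr \<theta>"
        unfolding Y_eq_sum[OF \<omega>] using \<omega> P_nonneg B_nonneg \<theta>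
        by (intro sum_powr_le_powr_sum) auto
      then show "(\<Sum>j<n. 1 * P n j \<omega> powr \<theta>) + 1 * Bt n \<omega> powr \<theta> \<le> Y n \<omega> powr \<theta>" by simp
    qed
    finally show ?thesis .
  qed
  \<comment> \<open>The bound holds for every partial sum, hence for the whole series as the
    supremum of its partial sums.\<close>
  have "(\<Sum>j. a j) * (SUP n. m n) + \<beta> = (SUP J. (\<Sum>j<J. a j) * (SUP n. m n) + \<beta>)"
    by (simp add: suminf_eq_SUP SUP_mult_right_ennreal ennreal_SUP_add_left)
  also have "\<dots> \<le> (SUP n. m n)" by (intro SUP_least SUP_m_ge step)
  finally have "(\<Sum>j. a j) * (SUP n. m n) + \<beta> \<le> (SUP n. m n)" .
  moreover have "1 * (SUP n. m n) \<le> (\<Sum>j. a j) * (SUP n. m n)" by (intro mult_right_mono sum) auto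
  ultimately have "(SUP n. m n) + \<beta> \<le> (SUP n. m n)"
    by (metis add_right_mono mult_1 order_trans)
  with neq \<beta>_pos show False
    by (metis add.right_neutral ennreal_add_left_cancel_le infinity_ennreal_def not_less)
qed

text \<open>Expectation of the weighted inequality with mass on the first \<open>J\<close>
  coefficients and on the noise only; it has the form required by \<open>SUP_m_ge\<close>.\<close>

lemma weighted_step:
  assumes \<theta>: "\<theta> \<le> 1" and w: "\<And>j. 0 \<le> w j" "0 \<le> v" "(\<Sum>j<J. w j) + v \<le> 1" and n: "J \<le> n"
  shows "(\<Sum>j<J. (ennreal (w j powr (1 - \<theta>)) * a j) * m (n - Suc j)) + ennreal (v powr (1 - \<theta>)) * \<beta>
    \<le> m n"
proof -
  \<comment> \<open>The indices from \<open>J\<close> to n - 1 get weight 0. Since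
    \<open>J \<le> n\<close>, the noise slot \<open>n\<close> does not collide with a
    coefficient.\<close>
  define u where "u j = (if j < J then w j else if j = n then v else 0)" for j
  have u: "0 \<le> u j" for j using w by (simp add: u_def)
  have usum: "(\<Sum>j<Suc n. u j) \<le> 1"
  proof -
    have "(\<Sum>j<n. u j) = (\<Sum>j<J. w j)"
      using n by (intro sum.mono_neutral_cong_right) (auto simp: u_def)
    then show ?thesis using n w by (simp add: u_def)
  qed
  have "(\<Sum>j<J. (ennreal (w j powr (1 - \<theta>)) * a j) * m (n - Suc j)) \<le>
      (\<Sum>j<n. ennreal (u j powr (1 - \<theta>)) * a j * m (n - Suc j))"
  proof -
    have "(\<Sum>j<J. (ennreal (w j powr (1 - \<theta>)) * a j) * m (n - Suc j)) =
        (\<Sum>j<J. ennreal (u j powr (1 - \<theta>)) * a j * m (n - Suc j))"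
      by (simp add: u_def)
    also have "\<dots> \<le> (\<Sum>j<n. ennreal (u j powr (1 - \<theta>)) * a j * m (n - Suc j))"
      using n by (intro sum_mono2) auto
    finally show ?thesis .
  qed
  then have "(\<Sum>j<J. (ennreal (w j powr (1 - \<theta>)) * a j) * m (n - Suc j)) + ennreal (v powr (1 - \<theta>)) * \<beta>
    \<le> (\<Sum>j<n. ennreal (u j powr (1 - \<theta>)) * a j * m (n - Suc j)) + ennreal (u n powr (1 - \<theta>)) * \<beta>"
    using n by (intro add_mono) (auto simp: u_def)
  also have "\<dots> = (\<integral>\<^sup>+\<omega>. ennreal ((\<Sum>j<n. u j powr (1 - \<theta>) * P n j \<omega> powr \<theta>)
        + u n powr (1 - \<theta>) * Bt n \<omega> powr \<theta>) \<partial>M)"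
    by (rule nn_integral_weighted[symmetric]) simp
  also have "\<dots> \<le> m n"
    unfolding m_def
  proof (intro nn_integral_mono ennreal_leI)
    fix \<omega> assume \<omega>: "\<omega> \<in> space M"
    have "(\<Sum>j\<in>{..<Suc n}. u j powr (1 - \<theta>) * (if j < n then P n j \<omega> else Bt n \<omega>) powr \<theta>) \<le> Y n \<omega> powr \<theta>"
      unfolding Y_eq_sum[OF \<omega>] using \<omega> P_nonneg B_nonneg \<theta> \<theta>_pos u usum
      by (intro weighted_sum_powr_le_powr_sum) auto
    then show "(\<Sum>j<n. u j powr (1 - \<theta>) * P n j \<omega> powr \<theta>)
        + u n powr (1 - \<theta>) * Bt n \<omega> powr \<theta> \<le> Y n \<omega> powr \<theta>" by simp
  qed
  finally show ?thesis .
qed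

text \<open>Suppose the supremum s is finite. With mass \<epsilon> on the noise and 1 - \<epsilon>
  on the coefficients, in proportion to the roots \<open>\<alpha> j\<close>, the weighted inequality
  yields (1 - \<epsilon>) s + \<epsilon> powr (1 - \<theta>) b \<le> s. Hence b \<le> \<epsilon>
  powr \<theta> s, which fails for small \<epsilon> because b > 0.\<close>

lemma SUP_m_infinite_less_1:
  assumes \<theta>: "\<theta> < 1" and or: "1 \<le> (\<Sum>j. ennreal_powr (a j) (1 / \<theta>)) \<or> \<beta> = \<infinity>"
  shows "(SUP n. m n) = \<infinity>"
proof (rule ccontr)
  assume neq: "(SUP n. m n) \<noteq> \<infinity>"
  then obtain s where s: "(SUP n. m n) = ennreal s" "0 \<le> s" by (cases "SUP n. m n") auto
  with \<beta>_le_SUP_m obtain b where b: "\<beta> = ennreal b" "0 \<le> b" "b \<le> s"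
    by (cases \<beta>) (auto simp: top_unique)
  then have b0: "0 < b" using \<beta>_pos by (simp add: ennreal_less_zero_iff)
  with b have s0: "0 < s" by simp
  have sum: "1 \<le> (\<Sum>j. ennreal_powr (a j) (1 / \<theta>))" using or b by simp
  have afin: "a j \<noteq> \<infinity>" for j
  proof
    assume inf: "a j = \<infinity>"
    \<comment> \<open>All mass sits on the index \<open>j\<close> and the noise gets weight 0; an
      infinite \<open>a j\<close> would then give \<infinity> s \<le> s, impossible for finite s >
      0.\<close>
    define w where "w i = (if i = j then 1 else 0 :: real)" for i
    have le: "(\<Sum>i<Suc j. ennreal (w i powr (1 - \<theta>)) * a i) * (SUP n. m n) + ennreal (0 powr (1 - \<theta>)) * \<beta>
        \<le> (SUP n. m n)"
      using \<theta> by (intro SUP_m_ge weighted_step) (auto simp: w_def)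
    have eq: "(\<Sum>i<Suc j. ennreal (w i powr (1 - \<theta>)) * a i) = \<top>"
      using inf by (simp add: w_def)
    show False using le s0 unfolding eq s(1) by (simp add: ennreal_top_mult top_unique)
  qed
  define \<alpha> where "\<alpha> j = enn2real (a j) powr (1 / \<theta>)" for j
  have \<alpha>: "ennreal_powr (a j) (1 / \<theta>) = ennreal (\<alpha> j)" "0 \<le> \<alpha> j" for j
    using afin[of j] by (auto simp: \<alpha>_def ennreal_powr_def)
  have a_eq: "a j = ennreal (\<alpha> j powr \<theta>)" for j
    using afin[of j] \<theta>_pos by (simp add: \<alpha>_def powr_powr less_top)
  have bound: "b \<le> \<epsilon> powr \<theta> * s" if \<epsilon>: "0 < \<epsilon>" "\<epsilon> < 1" for \<epsilon>
  proof -
    have "ennreal (1 - \<epsilon>) < 1" using \<epsilon> by (simp add: ennreal_less_one_iff)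
    also have "1 \<le> (\<Sum>j. ennreal (\<alpha> j))" using sum by (simp add: \<alpha>)
    finally obtain J where "ennreal (1 - \<epsilon>) < (\<Sum>j<J. ennreal (\<alpha> j))"
      by (auto simp: suminf_eq_SUP less_SUP_iff)
    then have J: "1 - \<epsilon> < (\<Sum>j<J. \<alpha> j)" using \<alpha> \<epsilon> by (simp add: ennreal_less_iff)
    define R where "R = (\<Sum>j<J. \<alpha> j)"
    have R: "0 < R" "1 - \<epsilon> \<le> R" using J \<epsilon> by (auto simp: R_def)
    \<comment> \<open>Normalized to total mass 1 - \<epsilon>, which leaves \<epsilon> for the
      noise.\<close>
    define w where "w j = (1 - \<epsilon>) / R * \<alpha> j" for j
    have wsum: "(\<Sum>j<J. w j) = 1 - \<epsilon>"
      unfolding w_def sum_distrib_left[symmetric] R_def[symmetric] using R by simp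
    have "(\<Sum>j<J. ennreal (w j powr (1 - \<theta>)) * a j) * (SUP n. m n) + ennreal (\<epsilon> powr (1 - \<theta>)) * \<beta>
        \<le> (SUP n. m n)"
      using \<theta> \<epsilon> R wsum \<alpha>(2) by (intro SUP_m_ge weighted_step) (auto simp: w_def)
    also have "(\<Sum>j<J. ennreal (w j powr (1 - \<theta>)) * a j)
        = ennreal (\<Sum>j<J. w j powr (1 - \<theta>) * \<alpha> j powr \<theta>)"
      by (simp add: a_eq flip: ennreal_mult sum_ennreal)
    also have "(\<Sum>j<J. w j powr (1 - \<theta>) * \<alpha> j powr \<theta>)
        = (\<Sum>j<J. ((1 - \<epsilon>) / R) powr (1 - \<theta>) * \<alpha> j)"
    proof (intro sum.cong refl)
      fix j
      have "\<alpha> j powr (1 - \<theta>) * \<alpha> j powr \<theta> = \<alpha> j"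
        using \<alpha>(2)[of j] by (simp flip: powr_add)
      then show "w j powr (1 - \<theta>) * \<alpha> j powr \<theta> = ((1 - \<epsilon>) / R) powr (1 - \<theta>) * \<alpha> j"
        unfolding w_def using \<alpha>(2)[of j] R \<epsilon>
        by (subst powr_mult) (auto simp: mult.assoc)
    qed
    also have "\<dots> = ((1 - \<epsilon>) / R) powr (1 - \<theta>) * R"
      unfolding R_def by (rule sum_distrib_left[symmetric])
    finally have *: "((1 - \<epsilon>) / R) powr (1 - \<theta>) * R * s + \<epsilon> powr (1 - \<theta>) * b \<le> s"
      using s b R by (simp flip: ennreal_mult ennreal_plus)
    \<comment> \<open>The partial sum \<open>R\<close> is at least 1 - \<epsilon>, so the factor of
      s in \<open>*\<close> is at least 1 - \<epsilon>.\<close>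
    have "1 - \<epsilon> = (1 - \<epsilon>) powr (1 - \<theta>) * (1 - \<epsilon>) powr \<theta>"
      using \<epsilon> by (simp flip: powr_add)
    also have "\<dots> \<le> (1 - \<epsilon>) powr (1 - \<theta>) * R powr \<theta>"
      using \<epsilon> R \<theta>_pos by (intro mult_left_mono powr_mono2) auto
    also have "\<dots> = ((1 - \<epsilon>) / R) powr (1 - \<theta>) * R"
      using R \<epsilon> by (simp add: powr_divide powr_diff)
    finally have "(1 - \<epsilon>) * s + \<epsilon> powr (1 - \<theta>) * b \<le> s"
      using * s0 by (smt (verit) mult_right_mono)
    then have "\<epsilon> powr (1 - \<theta>) * b \<le> \<epsilon> * s" by (simp add: algebra_simps)
    then show ?thesis using \<epsilon> by (simp add: powr_diff field_simps)
  qed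
  \<comment> \<open>Chosen so that \<epsilon> powr \<theta> s = b / 2; it is below 1 because b \<le>
    s.\<close>
  define \<epsilon> where "\<epsilon> = (b / (2 * s)) powr (1 / \<theta>)"
  have "\<epsilon> < 1 powr (1 / \<theta>)"
    unfolding \<epsilon>_def using b0 b s0 \<theta>_pos by (intro powr_less_mono2) auto
  then have "b \<le> \<epsilon> powr \<theta> * s" using b0 s0 by (intro bound) (auto simp: \<epsilon>_def)
  also have "\<dots> = b / 2" using b0 s0 \<theta>_pos by (simp add: \<epsilon>_def powr_powr)
  finally show False using b0 by simp
qed

end

section \<open>Stationarity and independence\<close>

text \<open>The solution at time \<open>n\<close> started from zero values before time 0, so that
  the series is a finite sum. The arrays are indexed by integer times, which allows them to be
  shifted freely in time.\<close>

fun rec_sol :: "(int \<Rightarrow> nat \<Rightarrow> real) \<Rightarrow> (int \<Rightarrow> real) \<Rightarrow> nat \<Rightarrow> real" where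
  "rec_sol a b n = (\<Sum>j<n. a (int n) (Suc j) * rec_sol a b (n - Suc j)) + b (int n)"

declare rec_sol.simps [simp del]

text \<open>Causality: the value at time \<open>n\<close> reads no coefficient after time
  \<open>n\<close> and no lag below 1. This is the source of the independence statements.\<close>

lemma rec_sol_cong:
  assumes "\<And>t j. t \<le> int n \<Longrightarrow> 1 \<le> j \<Longrightarrow> a t j = a' t j" "\<And>t. t \<le> int n \<Longrightarrow> b t = b' t"
  shows "rec_sol a b n = rec_sol a' b' n"
  using assms
proof (induction n rule: less_induct)
  case (less n)
  have "rec_sol a b (n - Suc j) = rec_sol a' b' (n - Suc j)" if "j < n" for j
    using that by (intro less.IH less.prems) auto
  then show ?case
    by (simp add: rec_sol.simps[of _ _ n] less.prems)
qed

lemma rec_sol_nonneg: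
  assumes "\<And>t j. 1 \<le> j \<Longrightarrow> 0 \<le> a t j" "\<And>t. 0 \<le> b t"
  shows "0 \<le> rec_sol a b n"
proof (induction n rule: less_induct)
  case (less n)
  then show ?case
    by (subst rec_sol.simps) (auto intro!: add_nonneg_nonneg sum_nonneg mult_nonneg_nonneg assms)
qed

text \<open>The right side solves the recursion with the same coefficients started one step earlier.
  Its last sum has one more non-negative term, of lag n + 1, and its other terms dominate by
  induction.\<close>

lemma rec_sol_shift_mono:
  assumes a: "\<And>t j. 1 \<le> j \<Longrightarrow> 0 \<le> a t j" and b: "\<And>t. 0 \<le> b t"
  shows "rec_sol a b n \<le> rec_sol (\<lambda>t. a (t - 1)) (\<lambda>t. b (t - 1)) (Suc n)"
proof (induction n rule: less_induct)
  case (less n)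
  let ?r = "rec_sol (\<lambda>t. a (t - 1)) (\<lambda>t. b (t - 1))"
  have "rec_sol a b (n - Suc j) \<le> ?r (n - j)" if "j < n" for j
    using less.IH[of "n - Suc j"] that by (simp add: Suc_diff_Suc)
  then have "rec_sol a b n \<le> (\<Sum>j<n. a (int n) (Suc j) * ?r (n - j)) + b (int n)"
    by (subst rec_sol.simps) (auto intro!: sum_mono mult_left_mono a)
  also have "\<dots> \<le> (\<Sum>j<Suc n. a (int n) (Suc j) * ?r (n - j)) + b (int n)"
    by (auto intro!: mult_nonneg_nonneg a b rec_sol_nonneg)
  also have "\<dots> = ?r (Suc n)"
    by (subst (2) rec_sol.simps) simp
  finally show ?case .
qed

text \<open>Measurability is asked only of the entries that are read, so that the lemma also applies
  on product spaces over past times.\<close>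

lemma measurable_rec_sol:
  assumes "\<And>t j. t \<le> int n \<Longrightarrow> 1 \<le> j \<Longrightarrow> (\<lambda>z. a z t j) \<in> borel_measurable N"
    and "\<And>t. t \<le> int n \<Longrightarrow> (\<lambda>z. b z t) \<in> borel_measurable N"
  shows "(\<lambda>z. rec_sol (a z) (b z) n) \<in> borel_measurable N"
  using assms
proof (induction n rule: less_induct)
  case (less n)
  have "(\<lambda>z. rec_sol (a z) (b z) (n - Suc j)) \<in> borel_measurable N" if "j < n" for j
    using that by (intro less.IH less.prems) auto
  then show ?case
    by (subst rec_sol.simps)
       (auto intro!: borel_measurable_add borel_measurable_sum borel_measurable_times less.prems)
qed

\<comment> \<open>Otherwise the simplifier rewrites \<open>{1..}\<close> in \<open>seq_space\<close> to \<open>{Suc 0..}\<close>, which no longer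
  matches the measurability facts.\<close>
declare One_nat_def [simp del]

lemma measurable_seq_component:
  assumes "f \<in> measurable N seq_space" "1 \<le> j"
  shows "(\<lambda>z. f z j) \<in> borel_measurable N"
  using measurable_compose[OF assms(1) measurable_component_singleton[of j "{1..}" "\<lambda>_. borel"]] assms(2)
  by simp

lemma measurable_process:
  assumes "\<And>t. W t \<in> measurable N S"
  shows "(\<lambda>\<omega> t. W (f t) \<omega>) \<in> measurable N (Pi\<^sub>M UNIV (\<lambda>_. S))"
  by (rule measurable_PiM_single') (auto simp: assms measurable_space[OF assms])

lemma nn_integral_eq_if_distr_eq:
  assumes "distr M S Y = distr N S Z" "Y \<in> measurable M S" "Z \<in> measurable N S"
    and "h \<in> borel_measurable S"
  shows "(\<integral>\<^sup>+\<omega>. h (Y \<omega>) \<partial>M) = (\<integral>\<^sup>+\<omega>. h (Z \<omega>) \<partial>N)"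
proof -
  have "(\<integral>\<^sup>+x. h x \<partial>distr M S Y) = (\<integral>\<^sup>+x. h x \<partial>distr N S Z)" by (simp only: assms(1))
  then show ?thesis using assms(2-4) by (simp only: nn_integral_distr measurable_distr_eq1)
qed

lemma distr_compose_eq:
  assumes "distr M S Y = distr N S Z" "Y \<in> measurable M S" "Z \<in> measurable N S"
    and "h \<in> measurable S T"
  shows "distr M T (\<lambda>\<omega>. h (Y \<omega>)) = distr N T (\<lambda>\<omega>. h (Z \<omega>))"
proof -
  have "distr (distr M S Y) T h = distr (distr N S Z) T h" by (simp only: assms(1))
  then show ?thesis using assms(2-4) by (simp only: distr_distr comp_def)
qed

section \<open>Independence and shift invariance of laws\<close>

context prob_space
begin

text \<open>The joint law is the product of the marginals, and Tonelli's theorem separates the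
  factors, with infinite values allowed.\<close>

lemma nn_integral_indep_mult:
  assumes ind: "indep_var S U T V"
    and [measurable]: "f \<in> borel_measurable S" "g \<in> borel_measurable T"
  shows "(\<integral>\<^sup>+\<omega>. f (U \<omega>) * g (V \<omega>) \<partial>M) = (\<integral>\<^sup>+\<omega>. f (U \<omega>) \<partial>M) * (\<integral>\<^sup>+\<omega>. g (V \<omega>) \<partial>M)"
proof -
  have [measurable]: "U \<in> measurable M S" "V \<in> measurable M T"
    and eq: "distr M S U \<Otimes>\<^sub>M distr M T V = distr M (S \<Otimes>\<^sub>M T) (\<lambda>x. (U x, V x))"
    using ind by (simp_all add: indep_var_distribution_eq)
  interpret T: prob_space "distr M T V" by (rule prob_space_distr) simp
  have "(\<integral>\<^sup>+\<omega>. f (U \<omega>) * g (V \<omega>) \<partial>M)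
      = (\<integral>\<^sup>+z. f (fst z) * g (snd z) \<partial>(distr M S U \<Otimes>\<^sub>M distr M T V))"
    unfolding eq by (simp add: nn_integral_distr)
  also have "\<dots> = (\<integral>\<^sup>+x. \<integral>\<^sup>+y. f x * g y \<partial>distr M T V \<partial>distr M S U)"
    by (subst T.nn_integral_fst[symmetric]) simp_all
  also have "\<dots> = (\<integral>\<^sup>+x. f x * (\<integral>\<^sup>+y. g y \<partial>distr M T V) \<partial>distr M S U)"
    by (simp add: nn_integral_cmult)
  also have "\<dots> = (\<integral>\<^sup>+\<omega>. f (U \<omega>) \<partial>M) * (\<integral>\<^sup>+\<omega>. g (V \<omega>) \<partial>M)"
    by (simp add: nn_integral_multc nn_integral_distr)
  finally show ?thesis .
qed

text \<open>Independence of the preimages factors the joint law on rectangles, and these determine a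
  product of sigma-finite measures.\<close>

lemma indep_elements_distr:
  assumes ind: "indep_elements M S Y T Z"
  shows "Y \<in> measurable M S" "Z \<in> measurable M T"
    and "distr M (S \<Otimes>\<^sub>M T) (\<lambda>\<omega>. (Y \<omega>, Z \<omega>)) = distr M S Y \<Otimes>\<^sub>M distr M T Z"
proof -
  show Y [measurable]: "Y \<in> measurable M S" and Z [measurable]: "Z \<in> measurable M T"
    using ind by (auto simp: indep_elements_def)
  interpret Y: prob_space "distr M S Y" by (rule prob_space_distr) fact
  interpret Z: prob_space "distr M T Z" by (rule prob_space_distr) fact
  show "distr M (S \<Otimes>\<^sub>M T) (\<lambda>\<omega>. (Y \<omega>, Z \<omega>)) = distr M S Y \<Otimes>\<^sub>M distr M T Z"
  proof (rule sym, rule pair_measure_eqI)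
    fix A B assume "A \<in> sets (distr M S Y)" "B \<in> sets (distr M T Z)"
    then have A [measurable]: "A \<in> sets S" and B [measurable]: "B \<in> sets T" by simp_all
    have "Y \<in> space M \<rightarrow> space S" "Z \<in> space M \<rightarrow> space T"
      using measurable_space[OF Y] measurable_space[OF Z] by auto
    then have "prob ((Y -` A \<inter> space M) \<inter> (Z -` B \<inter> space M))
        = prob (Y -` A \<inter> space M) * prob (Z -` B \<inter> space M)"
      using ind A B unfolding indep_elements_def
      by (intro indep_setD) (auto simp: sets_vimage_algebra2)
    moreover have "(\<lambda>\<omega>. (Y \<omega>, Z \<omega>)) -` (A \<times> B) \<inter> space M
        = (Y -` A \<inter> space M) \<inter> (Z -` B \<inter> space M)" by auto
    ultimately show "emeasure (distr M S Y) A * emeasure (distr M T Z) B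
        = emeasure (distr M (S \<Otimes>\<^sub>M T) (\<lambda>\<omega>. (Y \<omega>, Z \<omega>))) (A \<times> B)"
      by (simp add: emeasure_distr emeasure_eq_measure ennreal_mult)
  qed (auto intro: Y.sigma_finite_measure_axioms Z.sigma_finite_measure_axioms)
qed

lemma iid_copies_measurable: "iid_copies M W S N Z \<Longrightarrow> W t \<in> measurable M S"
  by (auto simp: iid_copies_def indep_vars_def)

text \<open>The law of the whole process is a product of identical factors, and such a product is
  invariant under injective reindexing, here t \<mapsto> t - s.\<close>

lemma iid_copies_shift_distr:
  fixes W :: "int \<Rightarrow> 'a \<Rightarrow> 'c"
  assumes iid: "iid_copies M W S N Z"
  shows "distr M (Pi\<^sub>M UNIV (\<lambda>_. S)) (\<lambda>\<omega> t. W (t - s) \<omega>) = Pi\<^sub>M UNIV (\<lambda>_. distr N S Z)"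
proof -
  have ind: "indep_vars (\<lambda>_. S) W UNIV" and law: "\<And>t. distr M S (W t) = distr N S Z"
    using iid by (auto simp: iid_copies_def)
  have W [measurable]: "\<And>t. W t \<in> measurable M S" using iid by (rule iid_copies_measurable)
  have D: "prob_space (distr N S Z)" using prob_space_distr[OF W] by (simp add: law)
  have 0: "distr M (Pi\<^sub>M UNIV (\<lambda>_. S)) (\<lambda>\<omega> t. W t \<omega>) = Pi\<^sub>M UNIV (\<lambda>_. distr N S Z)"
    using ind W by (subst (asm) indep_vars_iff_distr_eq_PiM) (auto simp: law restrict_def)
  have sets: "sets (Pi\<^sub>M UNIV (\<lambda>_::int. distr N S Z)) = sets (Pi\<^sub>M UNIV (\<lambda>_. S))"
    by (intro sets_PiM_cong) auto
  have [measurable]: "(\<lambda>w t. w (t - s)) \<in> measurable (Pi\<^sub>M UNIV (\<lambda>_. S)) (Pi\<^sub>M UNIV (\<lambda>_. S))"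
    "(\<lambda>\<omega> t. W t \<omega>) \<in> measurable M (Pi\<^sub>M UNIV (\<lambda>_. S))"
    using W by (auto intro!: measurable_process)
  have "distr M (Pi\<^sub>M UNIV (\<lambda>_. S)) (\<lambda>\<omega> t. W (t - s) \<omega>)
      = distr (distr M (Pi\<^sub>M UNIV (\<lambda>_. S)) (\<lambda>\<omega> t. W t \<omega>)) (Pi\<^sub>M UNIV (\<lambda>_. S)) (\<lambda>w t. w (t - s))"
    by (subst distr_distr) (auto simp: comp_def)
  also have "\<dots> = distr (Pi\<^sub>M UNIV (\<lambda>_. distr N S Z)) (Pi\<^sub>M UNIV (\<lambda>_. distr N S Z)) (\<lambda>w. \<lambda>t\<in>UNIV. w (t - s))"
    unfolding 0 by (intro distr_cong) (auto simp: sets)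
  also have "\<dots> = Pi\<^sub>M UNIV (\<lambda>_. distr N S Z)"
    by (rule distr_PiM_reindex) (auto simp: D inj_on_def)
  finally show ?thesis .
qed

end


section \<open>The random coefficient array\<close>

locale array_model = M0: prob_space M0 + M: prob_space M
  for M0 :: "'a measure" and A :: "nat \<Rightarrow> 'a \<Rightarrow> real" and B :: "'a \<Rightarrow> real"
    and M :: "'b measure" and At :: "int \<Rightarrow> nat \<Rightarrow> 'b \<Rightarrow> real" and Bt :: "int \<Rightarrow> 'b \<Rightarrow> real" +
  assumes measurable_A: "\<And>j. 1 \<le> j \<Longrightarrow> A j \<in> borel_measurable M0"
    and measurable_B [measurable]: "B \<in> borel_measurable M0"
    and measurable_At: "\<And>t j. 1 \<le> j \<Longrightarrow> At t j \<in> borel_measurable M"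
    and measurable_Bt [measurable]: "\<And>t. Bt t \<in> borel_measurable M"
    and At_nonneg: "\<And>t j \<omega>. 1 \<le> j \<Longrightarrow> \<omega> \<in> space M \<Longrightarrow> 0 \<le> At t j \<omega>"
    and Bt_nonneg: "\<And>t \<omega>. \<omega> \<in> space M \<Longrightarrow> 0 \<le> Bt t \<omega>"
    and cond: "cond_A1 M0 A B M At Bt \<or> cond_A2 M0 A B M At Bt"
begin

text \<open>\<open>sol s n\<close> is the solution at time \<open>n - s\<close> when the recursion is started at time \<open>-s\<close>.\<close>

definition sol :: "int \<Rightarrow> nat \<Rightarrow> 'b \<Rightarrow> real" where
  "sol s n \<omega> = rec_sol (\<lambda>t j. At (t - s) j \<omega>) (\<lambda>t. Bt (t - s) \<omega>) n"

lemma measurable_sol [measurable]: "sol s n \<in> borel_measurable M"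
  unfolding sol_def by (rule measurable_rec_sol) (auto intro: measurable_At)

lemma sol_nonneg: "\<omega> \<in> space M \<Longrightarrow> 0 \<le> sol s n \<omega>"
  unfolding sol_def by (intro rec_sol_nonneg At_nonneg Bt_nonneg)

lemma sol_shift_mono: "\<omega> \<in> space M \<Longrightarrow> sol s n \<omega> \<le> sol (s + 1) (Suc n) \<omega>"
  unfolding sol_def
  using rec_sol_shift_mono[of "\<lambda>t j. At (t - s) j \<omega>" "\<lambda>t. Bt (t - s) \<omega>" n]
  by (simp add: At_nonneg Bt_nonneg algebra_simps)

abbreviation noise_space :: "(int \<Rightarrow> real) measure" where
  "noise_space \<equiv> Pi\<^sub>M UNIV (\<lambda>_. borel)"

abbreviation coeff_space :: "(int \<times> nat \<Rightarrow> real) measure" where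
  "coeff_space \<equiv> Pi\<^sub>M (UNIV \<times> {1..}) (\<lambda>_. borel)"

text \<open>Together with \<open>coeff\<close>, this packs the time-shifted data into single random
  elements, so that stationarity becomes a statement about one joint law.\<close>

definition noise :: "int \<Rightarrow> 'b \<Rightarrow> int \<Rightarrow> real" where
  "noise s \<omega> = (\<lambda>t. Bt (t - s) \<omega>)"

definition coeff :: "int \<Rightarrow> 'b \<Rightarrow> int \<times> nat \<Rightarrow> real" where
  "coeff s \<omega> = (\<lambda>(t, j)\<in>UNIV \<times> {1..}. At (t - s) j \<omega>)"

lemma measurable_noise [measurable]: "noise s \<in> measurable M noise_space"
  unfolding noise_def by (rule measurable_PiM_single') auto

lemma measurable_coeff [measurable]: "coeff s \<in> measurable M coeff_space"
  unfolding coeff_def by (rule measurable_restrict) (auto intro: measurable_At)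

text \<open>Exhibits the solution as a fixed measurable function of noise and coefficients; its law
  is then determined by their joint law.\<close>

definition sol_map :: "(int \<Rightarrow> real) \<Rightarrow> (int \<times> nat \<Rightarrow> real) \<Rightarrow> nat \<Rightarrow> real" where
  "sol_map b a n = rec_sol (\<lambda>t j. a (t, j)) b n"

lemma measurable_sol_map:
  "(\<lambda>z. sol_map (fst z) (snd z) n) \<in> borel_measurable (noise_space \<Otimes>\<^sub>M coeff_space)"
  unfolding sol_map_def
  by (rule measurable_rec_sol)
     (auto intro!: measurable_compose[OF measurable_fst] measurable_compose[OF measurable_snd]
       measurable_component_singleton)

lemma sol_eq_sol_map: "sol s n \<omega> = sol_map (noise s \<omega>) (coeff s \<omega>) n"
  unfolding sol_def sol_map_def by (rule rec_sol_cong) (auto simp: noise_def coeff_def)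

lemma cond_A1_iid:
  assumes "cond_A1 M0 A B M At Bt"
  shows "iid_copies M (\<lambda>t \<omega>. (\<lambda>j\<in>{1..}. At t j \<omega>, Bt t \<omega>)) (seq_space \<Otimes>\<^sub>M borel)
    M0 (\<lambda>\<omega>. (\<lambda>j\<in>{1..}. A j \<omega>, B \<omega>))"
  using assms by (simp add: cond_A1_def)

lemma cond_A2_distr:
  assumes "cond_A2 M0 A B M At Bt"
  shows "distr M (noise_space \<Otimes>\<^sub>M coeff_space) (\<lambda>\<omega>. (noise 0 \<omega>, coeff 0 \<omega>))
    = distr M noise_space (noise 0) \<Otimes>\<^sub>M distr M coeff_space (coeff 0)"
  using assms M.indep_elements_distr(3) unfolding cond_A2_def noise_def coeff_def by fastforce

lemma cond_A2_iid:
  assumes "cond_A2 M0 A B M At Bt"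
  shows "iid_copies M (\<lambda>t \<omega>. \<lambda>j\<in>{1..}. At (t + int j) j \<omega>) seq_space M0 (\<lambda>\<omega>. \<lambda>j\<in>{1..}. A j \<omega>)"
    and "iid_copies M Bt borel M0 B"
  using assms by (auto simp: cond_A2_def)

lemma measurable_A_seq: "(\<lambda>\<omega>. \<lambda>j\<in>{1..}. A j \<omega>) \<in> measurable M0 seq_space"
  by (rule measurable_restrict) (auto intro: measurable_A)

lemma Bt_distr: "distr M borel (Bt t) = distr M0 borel B"
  using cond
proof
  assume A1: "cond_A1 M0 A B M At Bt"
  note iid = cond_A1_iid[OF this]
  have "distr M (seq_space \<Otimes>\<^sub>M borel) (\<lambda>\<omega>. (\<lambda>j\<in>{1..}. At t j \<omega>, Bt t \<omega>))
      = distr M0 (seq_space \<Otimes>\<^sub>M borel) (\<lambda>\<omega>. (\<lambda>j\<in>{1..}. A j \<omega>, B \<omega>))"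
    using iid by (simp add: iid_copies_def)
  from distr_compose_eq[OF this, of snd borel] show ?thesis
    using M.iid_copies_measurable[OF iid, of t] measurable_A_seq by simp
next
  assume "cond_A2 M0 A B M At Bt"
  from cond_A2_iid(2)[OF this] show ?thesis by (simp add: iid_copies_def)
qed

section \<open>Stationarity\<close>

text \<open>The rows \<open>W t\<close> are i.i.d., and the shifted data are the image of the
  shifted row process under a map \<open>G\<close> that does not depend on the shift.\<close>

lemma stationary_A1:
  assumes "cond_A1 M0 A B M At Bt"
  shows "distr M (noise_space \<Otimes>\<^sub>M coeff_space) (\<lambda>\<omega>. (noise s \<omega>, coeff s \<omega>))
    = distr M (noise_space \<Otimes>\<^sub>M coeff_space) (\<lambda>\<omega>. (noise 0 \<omega>, coeff 0 \<omega>))"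
proof -
  let ?S = "seq_space \<Otimes>\<^sub>M (borel :: real measure)"
  define W where "W t \<omega> = (\<lambda>j\<in>{1..}. At t j \<omega>, Bt t \<omega>)" for t \<omega>
  define G where "G w = (\<lambda>t. snd (w t), \<lambda>(t, j)\<in>UNIV \<times> {1..}. fst (w t) j)"
    for w :: "int \<Rightarrow> (nat \<Rightarrow> real) \<times> real"
  have iid: "iid_copies M W ?S M0 (\<lambda>\<omega>. (\<lambda>j\<in>{1..}. A j \<omega>, B \<omega>))"
    using cond_A1_iid[OF assms] by (simp add: W_def[abs_def])
  have W [measurable]: "\<And>t. W t \<in> measurable M ?S" using iid by (rule M.iid_copies_measurable)
  have G: "G \<in> measurable (Pi\<^sub>M UNIV (\<lambda>_. ?S)) (noise_space \<Otimes>\<^sub>M coeff_space)"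
    unfolding G_def
  proof (rule measurable_Pair)
    show "(\<lambda>w t. snd (w t)) \<in> measurable (Pi\<^sub>M UNIV (\<lambda>_. ?S)) noise_space"
      by (rule measurable_PiM_single') auto
    show "(\<lambda>w. \<lambda>(t, j)\<in>UNIV \<times> {1..}. fst (w t) j) \<in> measurable (Pi\<^sub>M UNIV (\<lambda>_. ?S)) coeff_space"
    proof (rule measurable_restrict)
      fix p :: "int \<times> nat" assume "p \<in> UNIV \<times> {1..}"
      then obtain t j where p: "p = (t, j)" and j: "1 \<le> j" by auto
      have "(\<lambda>w. fst (w t)) \<in> measurable (Pi\<^sub>M UNIV (\<lambda>_. ?S)) seq_space" by simp
      from measurable_seq_component[OF this j]
      show "(\<lambda>w. case p of (t, j) \<Rightarrow> fst (w t) j) \<in> borel_measurable (Pi\<^sub>M UNIV (\<lambda>_. ?S))"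
        by (simp add: p)
    qed
  qed
  have W': "(\<lambda>\<omega> t. W (t - s) \<omega>) \<in> measurable M (Pi\<^sub>M UNIV (\<lambda>_. ?S))" for s
    using W by (rule measurable_process)
  note shift = M.iid_copies_shift_distr[OF iid]
  have eq: "(noise s \<omega>, coeff s \<omega>) = G (\<lambda>t. W (t - s) \<omega>)" for s \<omega>
    by (auto simp: noise_def coeff_def G_def W_def restrict_def)
  show ?thesis
    unfolding eq
    by (rule distr_compose_eq[OF trans[OF shift[of s] shift[of 0, symmetric]] W' W' G])
qed

text \<open>Now the diagonals \<open>V t\<close> are i.i.d. Coefficients and noise are each shift
  invariant by the i.i.d. property. Shifting acts separately on the two components, so it preserves
  their independence, and the joint law is again the product of the marginals.\<close>

lemma stationary_A2:
  assumes A2: "cond_A2 M0 A B M At Bt"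
  shows "distr M (noise_space \<Otimes>\<^sub>M coeff_space) (\<lambda>\<omega>. (noise s \<omega>, coeff s \<omega>))
    = distr M (noise_space \<Otimes>\<^sub>M coeff_space) (\<lambda>\<omega>. (noise 0 \<omega>, coeff 0 \<omega>))"
proof -
  define V where "V t \<omega> = (\<lambda>j\<in>{1..}. At (t + int j) j \<omega>)" for t \<omega>
  \<comment> \<open>The entry at time \<open>t\<close> and lag \<open>j\<close> lies on the diagonal
    t - j, so \<open>H\<close> recovers the array from its diagonals.\<close>
  define H where "H v = (\<lambda>(t, j)\<in>UNIV \<times> {1..}. v (t - int j) j)" for v :: "int \<Rightarrow> nat \<Rightarrow> real"
  have iid: "iid_copies M V seq_space M0 (\<lambda>\<omega>. \<lambda>j\<in>{1..}. A j \<omega>)"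
    using cond_A2_iid(1)[OF A2] by (simp add: V_def[abs_def])
  have V [measurable]: "\<And>t. V t \<in> measurable M seq_space" using iid by (rule M.iid_copies_measurable)
  have H: "H \<in> measurable (Pi\<^sub>M UNIV (\<lambda>_. seq_space)) coeff_space"
    unfolding H_def
  proof (rule measurable_restrict)
    fix p :: "int \<times> nat" assume "p \<in> UNIV \<times> {1..}"
    then obtain t j where p: "p = (t, j)" and j: "1 \<le> j" by auto
    have "(\<lambda>w. w (t - int j)) \<in> measurable (Pi\<^sub>M UNIV (\<lambda>_. seq_space)) seq_space" by simp
    from measurable_seq_component[OF this j]
    show "(\<lambda>v. case p of (t, j) \<Rightarrow> v (t - int j) j) \<in> borel_measurable (Pi\<^sub>M UNIV (\<lambda>_. seq_space))"
      by (simp add: p)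
  qed
  have V': "(\<lambda>\<omega> t. V (t - s) \<omega>) \<in> measurable M (Pi\<^sub>M UNIV (\<lambda>_. seq_space))" for s
    using V by (rule measurable_process)
  note shift = M.iid_copies_shift_distr[OF iid]
  have eq: "coeff s = (\<lambda>\<omega>. H (\<lambda>t. V (t - s) \<omega>))" for s
    by (auto simp: coeff_def H_def V_def restrict_def fun_eq_iff algebra_simps)
  have a: "distr M coeff_space (coeff s) = distr M coeff_space (coeff 0)"
    unfolding eq
    by (rule distr_compose_eq[OF trans[OF shift[of s] shift[of 0, symmetric]] V' V' H])
  note shift = M.iid_copies_shift_distr[OF cond_A2_iid(2)[OF A2]]
  have b: "distr M noise_space (noise s) = distr M noise_space (noise 0)"
    unfolding noise_def by (rule trans[OF shift[of s] shift[of 0, symmetric]])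
  define f where "f b = (\<lambda>t. b (t - s))" for b :: "int \<Rightarrow> real"
  define g where "g a = (\<lambda>(t, j)\<in>UNIV \<times> {1..}. a (t - s, j))" for a :: "int \<times> nat \<Rightarrow> real"
  have f [measurable]: "f \<in> measurable noise_space noise_space"
    unfolding f_def by (rule measurable_PiM_single') auto
  have g [measurable]: "g \<in> measurable coeff_space coeff_space"
    unfolding g_def by (rule measurable_restrict) (auto intro: measurable_component_singleton)
  have fn: "noise s = (\<lambda>\<omega>. f (noise 0 \<omega>))" by (auto simp: f_def noise_def)
  have gc: "coeff s = (\<lambda>\<omega>. g (coeff 0 \<omega>))" by (auto simp: g_def coeff_def restrict_def fun_eq_iff)
  interpret g: prob_space "distr M coeff_space (coeff s)" by (rule M.prob_space_distr) simp
  have "distr M (noise_space \<Otimes>\<^sub>M coeff_space) (\<lambda>\<omega>. (noise s \<omega>, coeff s \<omega>))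
      = distr (distr M (noise_space \<Otimes>\<^sub>M coeff_space) (\<lambda>\<omega>. (noise 0 \<omega>, coeff 0 \<omega>)))
          (noise_space \<Otimes>\<^sub>M coeff_space) (\<lambda>(x, y). (f x, g y))"
    by (subst distr_distr) (auto simp: comp_def fn gc)
  also have "\<dots> = distr (distr M noise_space (noise 0) \<Otimes>\<^sub>M distr M coeff_space (coeff 0))
          (noise_space \<Otimes>\<^sub>M coeff_space) (\<lambda>(x, y). (f x, g y))"
    by (simp only: cond_A2_distr[OF A2])
  also have "\<dots> = distr (distr M noise_space (noise 0)) noise_space f
      \<Otimes>\<^sub>M distr (distr M coeff_space (coeff 0)) coeff_space g"
  proof (rule pair_measure_distr[symmetric])
    show "sigma_finite_measure (distr (distr M coeff_space (coeff 0)) coeff_space g)"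
      using g.sigma_finite_measure_axioms by (simp add: distr_distr comp_def gc)
  qed simp_all
  also have "\<dots> = distr M noise_space (noise s) \<Otimes>\<^sub>M distr M coeff_space (coeff s)"
    by (simp add: distr_distr comp_def fn gc)
  finally show ?thesis by (simp only: a b cond_A2_distr[OF A2])
qed

lemma sol_distr: "distr M borel (sol s n) = distr M borel (sol 0 n)"
  unfolding sol_eq_sol_map[abs_def]
  using distr_compose_eq[OF _ _ _ measurable_sol_map, of M "\<lambda>\<omega>. (noise s \<omega>, coeff s \<omega>)" M
      "\<lambda>\<omega>. (noise 0 \<omega>, coeff 0 \<omega>)" n] cond stationary_A1 stationary_A2
  by auto


section \<open>Factorization of the moments of the summands\<close>

text \<open>The coefficient belongs to row \<open>n\<close>, whereas the solution at time n - (j +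
  1) reads only rows before \<open>n\<close>; distinct rows are independent.\<close>

lemma product_moment_A1:
  assumes A1: "cond_A1 M0 A B M At Bt" and j: "j < n"
  shows "(\<integral>\<^sup>+\<omega>. ennreal ((At (int n) (Suc j) \<omega> * sol 0 (n - Suc j) \<omega>) powr \<theta>) \<partial>M)
    = (\<integral>\<^sup>+\<omega>. ennreal (A (Suc j) \<omega> powr \<theta>) \<partial>M0) * (\<integral>\<^sup>+\<omega>. ennreal (sol 0 (n - Suc j) \<omega> powr \<theta>) \<partial>M)"
proof -
  let ?S = "seq_space \<Otimes>\<^sub>M (borel :: real measure)"
  let ?I = "{int n}" and ?J = "{..<int n}"
  define W where "W t \<omega> = (\<lambda>j\<in>{1..}. At t j \<omega>, Bt t \<omega>)" for t \<omega>
  have iid: "iid_copies M W ?S M0 (\<lambda>\<omega>. (\<lambda>j\<in>{1..}. A j \<omega>, B \<omega>))"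
    using cond_A1_iid[OF A1] by (simp add: W_def[abs_def])
  then have ind: "M.indep_vars (\<lambda>_. ?S) W UNIV"
    and law: "distr M ?S (W (int n)) = distr M0 ?S (\<lambda>\<omega>. (\<lambda>j\<in>{1..}. A j \<omega>, B \<omega>))"
    by (simp_all add: iid_copies_def)
  have W: "\<And>t. W t \<in> measurable M ?S" using iid by (rule M.iid_copies_measurable)
  define h where "h w = ennreal (fst w (Suc j) powr \<theta>)" for w :: "(nat \<Rightarrow> real) \<times> real"
  define g where "g w = ennreal (rec_sol (\<lambda>t. fst (w t)) (\<lambda>t. snd (w t)) (n - Suc j) powr \<theta>)"
    for w :: "int \<Rightarrow> (nat \<Rightarrow> real) \<times> real"
  have "(\<lambda>w. fst w (Suc j)) \<in> borel_measurable ?S"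
    by (rule measurable_seq_component) simp_all
  then have h: "h \<in> borel_measurable ?S" unfolding h_def by measurable
  have "(\<lambda>w. rec_sol (\<lambda>t. fst (w t)) (\<lambda>t. snd (w t)) (n - Suc j)) \<in> borel_measurable (Pi\<^sub>M ?J (\<lambda>_. ?S))"
  proof (rule measurable_rec_sol)
    fix t assume "t \<le> int (n - Suc j)"
    then have t: "t \<in> ?J" using j by auto
    then have comp: "(\<lambda>w. w t) \<in> measurable (Pi\<^sub>M ?J (\<lambda>_. ?S)) ?S"
      by (rule measurable_component_singleton)
    show "(\<lambda>w. snd (w t)) \<in> borel_measurable (Pi\<^sub>M ?J (\<lambda>_. ?S))"
      using comp by (rule measurable_compose) simp
    fix i :: nat assume "1 \<le> i"
    then show "(\<lambda>w. fst (w t) i) \<in> borel_measurable (Pi\<^sub>M ?J (\<lambda>_. ?S))"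
      by (rule measurable_seq_component[OF measurable_compose[OF comp measurable_fst]])
  qed
  then have g: "g \<in> borel_measurable (Pi\<^sub>M ?J (\<lambda>_. ?S))" unfolding g_def by measurable
  have h': "(\<lambda>w. h (w (int n))) \<in> borel_measurable (Pi\<^sub>M ?I (\<lambda>_. ?S))"
    by (rule measurable_compose[OF _ h]) (rule measurable_component_singleton, simp)
  have At: "h (W (int n) \<omega>) = ennreal (At (int n) (Suc j) \<omega> powr \<theta>)" for \<omega>
    by (simp add: h_def W_def)
  have sol: "g (restrict (\<lambda>t. W t \<omega>) ?J) = ennreal (sol 0 (n - Suc j) \<omega> powr \<theta>)" for \<omega>
  proof -
    have "rec_sol (\<lambda>t. fst (restrict (\<lambda>t. W t \<omega>) ?J t)) (\<lambda>t. snd (restrict (\<lambda>t. W t \<omega>) ?J t)) (n - Suc j)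
        = sol 0 (n - Suc j) \<omega>"
      unfolding sol_def using j by (intro rec_sol_cong) (auto simp: W_def)
    then show ?thesis by (simp add: g_def)
  qed
  have "M.indep_var (Pi\<^sub>M ?I (\<lambda>_. ?S)) (\<lambda>\<omega>. restrict (\<lambda>t. W t \<omega>) ?I)
      (Pi\<^sub>M ?J (\<lambda>_. ?S)) (\<lambda>\<omega>. restrict (\<lambda>t. W t \<omega>) ?J)"
    by (rule M.indep_var_restrict[OF ind]) auto
  from M.nn_integral_indep_mult[OF this h' g]
  have "(\<integral>\<^sup>+\<omega>. ennreal (At (int n) (Suc j) \<omega> powr \<theta>) * ennreal (sol 0 (n - Suc j) \<omega> powr \<theta>) \<partial>M)
    = (\<integral>\<^sup>+\<omega>. h (W (int n) \<omega>) \<partial>M) * (\<integral>\<^sup>+\<omega>. ennreal (sol 0 (n - Suc j) \<omega> powr \<theta>) \<partial>M)"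
    by (simp add: sol At)
  also have "(\<integral>\<^sup>+\<omega>. h (W (int n) \<omega>) \<partial>M) = (\<integral>\<^sup>+\<omega>. h (\<lambda>j\<in>{1..}. A j \<omega>, B \<omega>) \<partial>M0)"
    using measurable_A_seq measurable_B
    by (intro nn_integral_eq_if_distr_eq[OF law W _ h] measurable_Pair)
  also have "\<dots> = (\<integral>\<^sup>+\<omega>. ennreal (A (Suc j) \<omega> powr \<theta>) \<partial>M0)" by (simp add: h_def)
  finally show ?thesis
    by (simp add: powr_mult At_nonneg sol_nonneg ennreal_mult cong: nn_integral_cong_simp)
qed

text \<open>The coefficient lies on the diagonal k = n - (j + 1), whereas the solution at time
  \<open>k\<close> reads, besides the noise, only diagonals below \<open>k\<close>. The moment
  factors for each fixed noise path, and integration over the independent noise gives the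
  claim.\<close>

lemma product_moment_A2:
  assumes A2: "cond_A2 M0 A B M At Bt" and j: "j < n"
  shows "(\<integral>\<^sup>+\<omega>. ennreal ((At (int n) (Suc j) \<omega> * sol 0 (n - Suc j) \<omega>) powr \<theta>) \<partial>M)
    = (\<integral>\<^sup>+\<omega>. ennreal (A (Suc j) \<omega> powr \<theta>) \<partial>M0) * (\<integral>\<^sup>+\<omega>. ennreal (sol 0 (n - Suc j) \<omega> powr \<theta>) \<partial>M)"
proof -
  define k where "k = n - Suc j"
  have nk: "int n = int k + int (Suc j)" using j by (simp add: k_def)
  let ?I = "{int k}" and ?J = "{..<int k}"
  define V where "V t \<omega> = (\<lambda>j\<in>{1..}. At (t + int j) j \<omega>)" for t \<omega>
  have iid: "iid_copies M V seq_space M0 (\<lambda>\<omega>. \<lambda>j\<in>{1..}. A j \<omega>)"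
    using cond_A2_iid(1)[OF A2] by (simp add: V_def[abs_def])
  then have ind: "M.indep_vars (\<lambda>_. seq_space) V UNIV"
    and law: "distr M seq_space (V (int k)) = distr M0 seq_space (\<lambda>\<omega>. \<lambda>j\<in>{1..}. A j \<omega>)"
    by (simp_all add: iid_copies_def)
  have V: "\<And>t. V t \<in> measurable M seq_space" using iid by (rule M.iid_copies_measurable)
  define h where "h v = ennreal (v (Suc j) powr \<theta>)" for v :: "nat \<Rightarrow> real"
  have "(\<lambda>v. v (Suc j)) \<in> borel_measurable seq_space"
    by (rule measurable_seq_component) simp_all
  then have h: "h \<in> borel_measurable seq_space" unfolding h_def by measurable
  have h': "(\<lambda>v. h (v (int k))) \<in> borel_measurable (Pi\<^sub>M ?I (\<lambda>_. seq_space))"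
    by (rule measurable_compose[OF _ h]) (rule measurable_component_singleton, simp)
  have At: "h (V (int k) \<omega>) = ennreal (At (int n) (Suc j) \<omega> powr \<theta>)" for \<omega>
    by (simp add: h_def V_def nk)
  have EA: "(\<integral>\<^sup>+\<omega>. ennreal (At (int n) (Suc j) \<omega> powr \<theta>) \<partial>M) = (\<integral>\<^sup>+\<omega>. ennreal (A (Suc j) \<omega> powr \<theta>) \<partial>M0)"
  proof -
    have "(\<integral>\<^sup>+\<omega>. h (V (int k) \<omega>) \<partial>M) = (\<integral>\<^sup>+\<omega>. h (\<lambda>j\<in>{1..}. A j \<omega>) \<partial>M0)"
      using measurable_A_seq by (intro nn_integral_eq_if_distr_eq[OF law V _ h])
    then show ?thesis by (simp add: At) (simp add: h_def)
  qed
  have fixed_noise: "(\<integral>\<^sup>+\<omega>. ennreal (At (int n) (Suc j) \<omega> powr \<theta>) * ennreal (sol_map b (coeff 0 \<omega>) k powr \<theta>) \<partial>M)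
      = (\<integral>\<^sup>+\<omega>. ennreal (A (Suc j) \<omega> powr \<theta>) \<partial>M0) * (\<integral>\<^sup>+\<omega>. ennreal (sol_map b (coeff 0 \<omega>) k powr \<theta>) \<partial>M)"
    for b
  proof -
    define g where "g v = ennreal (rec_sol (\<lambda>t i. v (t - int i) i) b k powr \<theta>)"
      for v :: "int \<Rightarrow> nat \<Rightarrow> real"
    have "(\<lambda>v. rec_sol (\<lambda>t i. v (t - int i) i) b k) \<in> borel_measurable (Pi\<^sub>M ?J (\<lambda>_. seq_space))"
    proof (rule measurable_rec_sol)
      fix t and i :: nat assume t: "t \<le> int k" and i: "1 \<le> i"
      \<comment> \<open>Lags start at 1, so times up to \<open>k\<close> only involve diagonals
        strictly below \<open>k\<close>.\<close>
      then have "t - int i \<in> ?J" by auto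
      then have "(\<lambda>w. w (t - int i)) \<in> measurable (Pi\<^sub>M ?J (\<lambda>_. seq_space)) seq_space"
        by (rule measurable_component_singleton)
      from measurable_seq_component[OF this i]
      show "(\<lambda>v. v (t - int i) i) \<in> borel_measurable (Pi\<^sub>M ?J (\<lambda>_. seq_space))" .
    qed simp
    then have g: "g \<in> borel_measurable (Pi\<^sub>M ?J (\<lambda>_. seq_space))" unfolding g_def by measurable
    have sol: "g (restrict (\<lambda>t. V t \<omega>) ?J) = ennreal (sol_map b (coeff 0 \<omega>) k powr \<theta>)" for \<omega>
    proof -
      have "rec_sol (\<lambda>t i. restrict (\<lambda>t. V t \<omega>) ?J (t - int i) i) b k = sol_map b (coeff 0 \<omega>) k"
        unfolding sol_map_def by (intro rec_sol_cong) (auto simp: V_def coeff_def)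
      then show ?thesis by (simp add: g_def)
    qed
    have "M.indep_var (Pi\<^sub>M ?I (\<lambda>_. seq_space)) (\<lambda>\<omega>. restrict (\<lambda>t. V t \<omega>) ?I)
        (Pi\<^sub>M ?J (\<lambda>_. seq_space)) (\<lambda>\<omega>. restrict (\<lambda>t. V t \<omega>) ?J)"
      by (rule M.indep_var_restrict[OF ind]) auto
    from M.nn_integral_indep_mult[OF this h' g] show ?thesis
      by (simp add: sol At EA)
  qed
  let ?N = "distr M noise_space (noise 0)" and ?C = "distr M coeff_space (coeff 0)"
  interpret C: prob_space ?C by (rule M.prob_space_distr) simp
  \<comment> \<open>Tonelli's theorem for the product law of noise and coefficients, with the noise
    path as the outer variable.\<close>
  have integral_eq: "(\<integral>\<^sup>+\<omega>. F (coeff 0 \<omega>) * ennreal (sol 0 k \<omega> powr \<theta>) \<partial>M)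
      = (\<integral>\<^sup>+b. \<integral>\<^sup>+\<omega>. F (coeff 0 \<omega>) * ennreal (sol_map b (coeff 0 \<omega>) k powr \<theta>) \<partial>M \<partial>?N)"
    if F [measurable]: "F \<in> borel_measurable coeff_space" for F :: "(int \<times> nat \<Rightarrow> real) \<Rightarrow> ennreal"
  proof -
    note measurable_sol_map[of k, measurable]
    have "(\<lambda>z. ennreal (sol_map (fst z) (snd z) k powr \<theta>)) \<in> borel_measurable (noise_space \<Otimes>\<^sub>M coeff_space)"
      by measurable
    then have m: "(\<lambda>z. F (snd z) * ennreal (sol_map (fst z) (snd z) k powr \<theta>))
        \<in> borel_measurable (noise_space \<Otimes>\<^sub>M coeff_space)" by measurable
    have "(\<integral>\<^sup>+\<omega>. F (coeff 0 \<omega>) * ennreal (sol 0 k \<omega> powr \<theta>) \<partial>M)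
        = (\<integral>\<^sup>+z. F (snd z) * ennreal (sol_map (fst z) (snd z) k powr \<theta>)
            \<partial>distr M (noise_space \<Otimes>\<^sub>M coeff_space) (\<lambda>\<omega>. (noise 0 \<omega>, coeff 0 \<omega>)))"
      using m by (subst nn_integral_distr) (auto simp: sol_eq_sol_map)
    also have "\<dots> = (\<integral>\<^sup>+z. F (snd z) * ennreal (sol_map (fst z) (snd z) k powr \<theta>) \<partial>(?N \<Otimes>\<^sub>M ?C))"
      by (simp only: cond_A2_distr[OF A2])
    also have "\<dots> = (\<integral>\<^sup>+b. \<integral>\<^sup>+a. F a * ennreal (sol_map b a k powr \<theta>) \<partial>?C \<partial>?N)"
      using m by (subst C.nn_integral_fst[symmetric]) auto
    also have "\<dots> = (\<integral>\<^sup>+b. \<integral>\<^sup>+\<omega>. F (coeff 0 \<omega>) * ennreal (sol_map b (coeff 0 \<omega>) k powr \<theta>) \<partial>M \<partial>?N)"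
    proof (intro nn_integral_cong nn_integral_distr measurable_coeff)
      fix b assume "b \<in> space ?N"
      then have b: "Pair b \<in> measurable coeff_space (noise_space \<Otimes>\<^sub>M coeff_space)"
        by (intro measurable_Pair1') simp
      from measurable_compose[OF b m]
      show "(\<lambda>a. F a * ennreal (sol_map b a k powr \<theta>)) \<in> borel_measurable ?C" by simp
    qed
    finally show ?thesis .
  qed
  define F where "F a = ennreal (a (int n, Suc j) powr \<theta>)" for a :: "int \<times> nat \<Rightarrow> real"
  have "(\<lambda>a. a (int n, Suc j)) \<in> borel_measurable coeff_space"
    by (rule measurable_component_singleton) simp
  then have F: "F \<in> borel_measurable coeff_space" unfolding F_def by measurable
  have Fc: "F (coeff 0 \<omega>) = ennreal (At (int n) (Suc j) \<omega> powr \<theta>)" for \<omega>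
    by (simp add: F_def coeff_def)
  have "(\<lambda>z. ennreal (sol_map (fst z) (snd z) k powr \<theta>)) \<in> borel_measurable (?N \<Otimes>\<^sub>M ?C)"
    using measurable_sol_map[of k] by simp
  then have "(\<lambda>b. \<integral>\<^sup>+a. ennreal (sol_map b a k powr \<theta>) \<partial>?C) \<in> borel_measurable ?N"
    using C.borel_measurable_nn_integral_fst by fastforce
  \<comment> \<open>Measurability in the noise path allows the constant moment of the coefficient to
    be pulled out of the outer integral.\<close>
  then have m: "(\<lambda>b. \<integral>\<^sup>+\<omega>. ennreal (sol_map b (coeff 0 \<omega>) k powr \<theta>) \<partial>M) \<in> borel_measurable ?N"
  proof (rule measurable_cong[THEN iffD1, rotated])
    fix b assume "b \<in> space ?N"
    then have "Pair b \<in> measurable coeff_space (noise_space \<Otimes>\<^sub>M coeff_space)"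
      by (intro measurable_Pair1') simp
    from measurable_compose[OF this measurable_sol_map]
    have "(\<lambda>a. sol_map b a k) \<in> borel_measurable coeff_space" by simp
    then show "(\<integral>\<^sup>+a. ennreal (sol_map b a k powr \<theta>) \<partial>?C) = (\<integral>\<^sup>+\<omega>. ennreal (sol_map b (coeff 0 \<omega>) k powr \<theta>) \<partial>M)"
      by (intro nn_integral_distr measurable_coeff) simp
  qed
  \<comment> \<open>\<open>integral_eq\<close> is used with \<open>F\<close> for the mixed moment
    and with the constant 1 for the moment of the solution; \<open>fixed_noise\<close> relates the
    inner integrals.\<close>
  have "(\<integral>\<^sup>+\<omega>. ennreal (At (int n) (Suc j) \<omega> powr \<theta>) * ennreal (sol 0 k \<omega> powr \<theta>) \<partial>M)
    = (\<integral>\<^sup>+\<omega>. ennreal (A (Suc j) \<omega> powr \<theta>) \<partial>M0) * (\<integral>\<^sup>+\<omega>. ennreal (sol 0 k \<omega> powr \<theta>) \<partial>M)"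
    using integral_eq[OF F] integral_eq[of "\<lambda>_. 1"] m
    by (simp add: Fc fixed_noise nn_integral_cmult)
  then show ?thesis
    unfolding k_def[symmetric]
    by (simp add: powr_mult At_nonneg sol_nonneg ennreal_mult cong: nn_integral_cong_simp)
qed

lemma product_moment:
  "j < n \<Longrightarrow> (\<integral>\<^sup>+\<omega>. ennreal ((At (int n) (Suc j) \<omega> * sol 0 (n - Suc j) \<omega>) powr \<theta>) \<partial>M)
    = (\<integral>\<^sup>+\<omega>. ennreal (A (Suc j) \<omega> powr \<theta>) \<partial>M0) * (\<integral>\<^sup>+\<omega>. ennreal (sol 0 (n - Suc j) \<omega> powr \<theta>) \<partial>M)"
  using cond product_moment_A1 product_moment_A2 by blast

end

section \<open>The limit law and its moments\<close>

text \<open>A bounded continuous substitute for the \<theta>-th power, hence an admissible test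
  function for convergence in law. Truncation precedes \<open>enn2real\<close>, which would send
  \<infinity> to 0.\<close>

definition truncated_powr :: "real \<Rightarrow> nat \<Rightarrow> ennreal \<Rightarrow> real" where
  "truncated_powr \<theta> K x = enn2real (min x (ennreal (real K))) powr \<theta>"

lemma truncated_powr_nonneg [simp]: "0 \<le> truncated_powr \<theta> K x"
  by (simp add: truncated_powr_def)

lemma truncated_powr_mono:
  assumes "0 < \<theta>" "x \<le> y"
  shows "truncated_powr \<theta> K x \<le> truncated_powr \<theta> K y"
  using assms unfolding truncated_powr_def
  by (intro powr_mono2 enn2real_mono) (auto simp: min_le_iff_disj min_less_iff_disj)

lemma truncated_powr_mono_level:
  assumes "0 < \<theta>" "K \<le> L"
  shows "truncated_powr \<theta> K x \<le> truncated_powr \<theta> L x"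
  using assms unfolding truncated_powr_def
  by (intro powr_mono2 enn2real_mono) (auto simp: min_le_iff_disj min_less_iff_disj intro!: disjI2 ennreal_leI)

lemma truncated_powr_le:
  assumes "0 < \<theta>"
  shows "truncated_powr \<theta> K x \<le> real K powr \<theta>"
proof -
  have "enn2real (min x (ennreal (real K))) \<le> enn2real (ennreal (real K))"
    by (intro enn2real_mono) auto
  then show ?thesis using assms unfolding truncated_powr_def by (intro powr_mono2) auto
qed

lemma continuous_truncated_powr:
  assumes "0 < \<theta>"
  shows "continuous_on UNIV (truncated_powr \<theta> K)"
proof (intro continuous_at_imp_continuous_on ballI)
  fix x :: ennreal
  have "min x (ennreal (real K)) < \<top>" by (simp add: min_less_iff_disj)
  then have eq: "ennreal (enn2real (min x (ennreal (real K)))) = min x (ennreal (real K))" by simp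
  have "((\<lambda>y. min y (ennreal (real K))) \<longlongrightarrow> ennreal (enn2real (min x (ennreal (real K))))) (at x)"
    unfolding eq by (intro tendsto_min tendsto_ident_at tendsto_const)
  then have "((\<lambda>y. enn2real (min y (ennreal (real K)))) \<longlongrightarrow> enn2real (min x (ennreal (real K)))) (at x)"
    by (rule tendsto_enn2real) simp
  then show "isCont (truncated_powr \<theta> K) x"
    unfolding isCont_def truncated_powr_def using assms by (intro tendsto_powr') auto
qed

text \<open>For finite \<open>x\<close> the supremum is attained as soon as K \<ge> x; at
  \<infinity> the values are the powers of K, which are unbounded.\<close>

lemma ennreal_powr_eq_SUP:
  assumes "0 < \<theta>"
  shows "ennreal_powr x \<theta> = (SUP K. ennreal (truncated_powr \<theta> K x))"
proof (cases x)
  case (real r)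
  obtain L :: nat where L: "r \<le> real L" using real_arch_simple by blast
  have "truncated_powr \<theta> K x \<le> r powr \<theta>" for K
  proof -
    have "enn2real (min x (ennreal (real K))) \<le> enn2real x"
      using real by (intro enn2real_mono) auto
    then show ?thesis using assms real unfolding truncated_powr_def by (intro powr_mono2) auto
  qed
  moreover have "truncated_powr \<theta> L x = r powr \<theta>"
    using L real by (simp add: truncated_powr_def min_def)
  ultimately have "(SUP K. ennreal (truncated_powr \<theta> K x)) = ennreal (r powr \<theta>)"
    by (intro antisym SUP_least ennreal_leI) (auto intro!: SUP_upper2[of L])
  then show ?thesis using real by (simp add: ennreal_powr_ennreal)
next
  case top
  have "(SUP K. ennreal (truncated_powr \<theta> K x)) = \<top>"
  proof (rule ennreal_SUP_eq_top)
    fix n :: nat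
    obtain K :: nat where K: "real n powr (1 / \<theta>) \<le> real K" using real_arch_simple by blast
    have "real n = (real n powr (1 / \<theta>)) powr \<theta>" using assms by (simp add: powr_powr)
    also have "\<dots> \<le> real K powr \<theta>" using K assms by (intro powr_mono2) auto
    also have "\<dots> = truncated_powr \<theta> K x" using top by (simp add: truncated_powr_def)
    finally show "\<exists>K\<in>UNIV. of_nat n \<le> ennreal (truncated_powr \<theta> K x)"
      by (auto simp: ennreal_of_nat_eq_real_of_nat intro!: ennreal_leI)
  qed
  then show ?thesis using top by (simp only: ennreal_powr_def infinity_ennreal_def simp_thms if_True)
qed

text \<open>Monotone convergence expresses the moment through integrals of test functions, which
  makes it accessible to convergence in law.\<close>

lemma (in prob_space) moment_eq_SUP_truncated:
  assumes [measurable]: "Z \<in> borel_measurable M" and \<theta>: "0 < \<theta>"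
  shows "moment M Z \<theta> = (SUP K. ennreal (\<integral>\<omega>. truncated_powr \<theta> K (Z \<omega>) \<partial>M))"
proof -
  have [measurable]: "truncated_powr \<theta> K \<in> borel_measurable borel" for K
    by (rule borel_measurable_continuous_onI[OF continuous_truncated_powr[OF \<theta>]])
  have "moment M Z \<theta> = (SUP K. \<integral>\<^sup>+\<omega>. ennreal (truncated_powr \<theta> K (Z \<omega>)) \<partial>M)"
    unfolding moment_def ennreal_powr_eq_SUP[OF \<theta>]
    by (intro nn_integral_monotone_convergence_SUP)
       (auto intro!: incseq_SucI le_funI ennreal_leI truncated_powr_mono_level[OF \<theta>])
  also have "\<dots> = (SUP K. ennreal (\<integral>\<omega>. truncated_powr \<theta> K (Z \<omega>) \<partial>M))"
  proof (intro SUP_cong refl)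
    fix K
    show "(\<integral>\<^sup>+\<omega>. ennreal (truncated_powr \<theta> K (Z \<omega>)) \<partial>M)
        = ennreal (\<integral>\<omega>. truncated_powr \<theta> K (Z \<omega>) \<partial>M)"
      using truncated_powr_le[OF \<theta>]
      by (intro nn_integral_eq_integral integrable_const_bound[where B = "real K powr \<theta>"]) auto
  qed
  finally show ?thesis .
qed

section \<open>Monotone coupling and the limit in law\<close>

text \<open>\<open>Y\<close> realizes each single law of \<open>X\<close> by a pointwise increasing
  sequence; the joint laws of the two sequences may differ.\<close>

locale monotone_coupling = prob_space M for M :: "'b measure" +
  fixes X Y :: "nat \<Rightarrow> 'b \<Rightarrow> real"
  assumes measurable_X [measurable]: "\<And>n. X n \<in> borel_measurable M"
    and measurable_Y [measurable]: "\<And>n. Y n \<in> borel_measurable M"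
    and same_law: "\<And>n. distr M borel (Y n) = distr M borel (X n)"
    and Y_mono: "\<And>n \<omega>. \<omega> \<in> space M \<Longrightarrow> Y n \<omega> \<le> Y (Suc n) \<omega>"
begin

lemma integral_X_eq_integral_Y:
  fixes f :: "ennreal \<Rightarrow> real"
  assumes [measurable]: "f \<in> borel_measurable borel"
  shows "(\<integral>\<omega>. f (ennreal (X n \<omega>)) \<partial>M) = (\<integral>\<omega>. f (ennreal (Y n \<omega>)) \<partial>M)"
proof -
  have "(\<integral>x. f (ennreal x) \<partial>distr M borel (X n)) = (\<integral>x. f (ennreal x) \<partial>distr M borel (Y n))"
    by (simp only: same_law)
  then show ?thesis by (simp add: integral_distr)
qed

text \<open>\<open>Y\<close> increases to its supremum in [0,\<infinity>], so continuity of the test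
  function and dominated convergence give the limit.\<close>

lemma converges_to_supremum:
  "converges_in_law M (\<lambda>n \<omega>. ennreal (X n \<omega>)) (distr M borel (\<lambda>\<omega>. SUP n. ennreal (Y n \<omega>))) (\<lambda>x. x)"
  unfolding converges_in_law_def
proof (intro allI impI)
  fix f :: "ennreal \<Rightarrow> real"
  assume cont: "continuous_on UNIV f" and "bounded (range f)"
  then obtain K where K: "\<And>x. norm (f x) \<le> K" by (auto simp: bounded_iff)
  have f [measurable]: "f \<in> borel_measurable borel"
    by (rule borel_measurable_continuous_onI[OF cont])
  have "(\<lambda>n. \<integral>\<omega>. f (ennreal (Y n \<omega>)) \<partial>M) \<longlonglongrightarrow> (\<integral>\<omega>. f (SUP n. ennreal (Y n \<omega>)) \<partial>M)"
  proof (rule integral_dominated_convergence[where w = "\<lambda>_. K"])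
    show "AE \<omega> in M. (\<lambda>n. f (ennreal (Y n \<omega>))) \<longlonglongrightarrow> f (SUP n. ennreal (Y n \<omega>))"
    proof (rule AE_I2)
      fix \<omega> assume "\<omega> \<in> space M"
      then have "(\<lambda>n. ennreal (Y n \<omega>)) \<longlonglongrightarrow> (SUP n. ennreal (Y n \<omega>))"
        by (intro LIMSEQ_SUP incseq_SucI ennreal_leI Y_mono)
      then show "(\<lambda>n. f (ennreal (Y n \<omega>))) \<longlonglongrightarrow> f (SUP n. ennreal (Y n \<omega>))"
        by (rule continuous_on_tendsto_compose[OF cont]) auto
    qed
  qed (use K in auto)
  then show "(\<lambda>n. \<integral>\<omega>. f (ennreal (X n \<omega>)) \<partial>M)
      \<longlonglongrightarrow> (\<integral>x. f x \<partial>distr M borel (\<lambda>\<omega>. SUP n. ennreal (Y n \<omega>)))"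
    by (simp add: integral_X_eq_integral_Y integral_distr)
qed

lemma truncated_moment_mono:
  assumes \<theta>: "0 < \<theta>"
  shows "incseq (\<lambda>n. \<integral>\<omega>. truncated_powr \<theta> K (ennreal (X n \<omega>)) \<partial>M)"
proof (rule incseq_SucI)
  fix n
  have [measurable]: "truncated_powr \<theta> K \<in> borel_measurable borel"
    by (rule borel_measurable_continuous_onI[OF continuous_truncated_powr[OF \<theta>]])
  have "(\<integral>\<omega>. truncated_powr \<theta> K (ennreal (Y n \<omega>)) \<partial>M)
      \<le> (\<integral>\<omega>. truncated_powr \<theta> K (ennreal (Y (Suc n) \<omega>)) \<partial>M)"
    using truncated_powr_le[OF \<theta>]
    by (intro integral_mono integrable_const_bound[where B = "real K powr \<theta>"]
        truncated_powr_mono[OF \<theta>] ennreal_leI Y_mono) auto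
  then show "(\<integral>\<omega>. truncated_powr \<theta> K (ennreal (X n \<omega>)) \<partial>M)
      \<le> (\<integral>\<omega>. truncated_powr \<theta> K (ennreal (X (Suc n) \<omega>)) \<partial>M)"
    by (simp add: integral_X_eq_integral_Y)
qed

lemma moment_mono:
  assumes "0 < \<theta>"
  shows "incseq (\<lambda>n. moment M (\<lambda>\<omega>. ennreal (X n \<omega>)) \<theta>)"
  using truncated_moment_mono[OF assms]
  by (intro incseq_SucI) (auto simp: moment_eq_SUP_truncated assms intro!: SUP_mono' ennreal_leI dest: incseq_SucD)

text \<open>For a fixed truncation level, the integrals converge by convergence in law and increase
  in \<open>n\<close>, so the limit is a supremum. Exchanging the suprema over level and time yields
  the moment, for any realization \<open>Z\<close> of the limit.\<close>

lemma moment_limit: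
  assumes N: "prob_space N" and Z: "Z \<in> borel_measurable N" and \<theta>: "0 < \<theta>"
    and lim: "converges_in_law M (\<lambda>n \<omega>. ennreal (X n \<omega>)) N Z"
  shows "moment N Z \<theta> = (SUP n. moment M (\<lambda>\<omega>. ennreal (X n \<omega>)) \<theta>)"
proof -
  define c where "c n K = (\<integral>\<omega>. truncated_powr \<theta> K (ennreal (X n \<omega>)) \<partial>M)" for n K
  have trunc: "ennreal (\<integral>\<omega>. truncated_powr \<theta> K (Z \<omega>) \<partial>N) = (SUP n. ennreal (c n K))" for K
  proof (rule LIMSEQ_unique)
    have "bounded (range (truncated_powr \<theta> K))"
      using truncated_powr_le[OF \<theta>] by (auto intro!: boundedI[of _ "real K powr \<theta>"])
    with lim have "(\<lambda>n. c n K) \<longlonglongrightarrow> (\<integral>\<omega>. truncated_powr \<theta> K (Z \<omega>) \<partial>N)"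
      unfolding converges_in_law_def c_def using continuous_truncated_powr[OF \<theta>] by blast
    then show "(\<lambda>n. ennreal (c n K)) \<longlonglongrightarrow> ennreal (\<integral>\<omega>. truncated_powr \<theta> K (Z \<omega>) \<partial>N)"
      by (rule tendsto_ennrealI)
    show "(\<lambda>n. ennreal (c n K)) \<longlonglongrightarrow> (SUP n. ennreal (c n K))"
      using truncated_moment_mono[OF \<theta>, of K]
      by (intro LIMSEQ_SUP) (auto simp: c_def mono_def intro!: ennreal_leI)
  qed
  have "moment N Z \<theta> = (SUP K. SUP n. ennreal (c n K))"
    by (simp add: prob_space.moment_eq_SUP_truncated[OF N Z \<theta>] trunc)
  also have "\<dots> = (SUP n. SUP K. ennreal (c n K))" by (rule SUP_commute)
  finally show ?thesis by (simp add: moment_eq_SUP_truncated \<theta> c_def)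
qed

end

lemma moment_nonneg_eq:
  assumes "\<And>\<omega>. \<omega> \<in> space M \<Longrightarrow> 0 \<le> f \<omega>"
  shows "moment M (\<lambda>\<omega>. ennreal (f \<omega>)) \<theta> = (\<integral>\<^sup>+\<omega>. ennreal (f \<omega> powr \<theta>) \<partial>M)"
  unfolding moment_def using assms by (intro nn_integral_cong) (simp add: ennreal_powr_ennreal)

text \<open>A zero moment would force \<open>f\<close> to vanish almost surely.\<close>

lemma (in prob_space) moment_pos:
  assumes [measurable]: "f \<in> borel_measurable M" and nonneg: "\<And>\<omega>. \<omega> \<in> space M \<Longrightarrow> 0 \<le> f \<omega>"
    and "measure M {\<omega> \<in> space M. f \<omega> = 0} < 1"
  shows "0 < moment M (\<lambda>\<omega>. ennreal (f \<omega>)) \<theta>"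
proof (rule ccontr)
  assume "\<not> 0 < moment M (\<lambda>\<omega>. ennreal (f \<omega>)) \<theta>"
  then have "(\<integral>\<^sup>+\<omega>. ennreal (f \<omega> powr \<theta>) \<partial>M) = 0" by (simp add: moment_nonneg_eq nonneg)
  then have "AE \<omega> in M. f \<omega> = 0" by (simp add: nn_integral_0_iff_AE)
  then have "prob {\<omega> \<in> space M. f \<omega> = 0} = 1" by (subst prob_Collect_eq_1) auto
  with assms(3) show False by simp
qed

section \<open>Application to the random recursion\<close>

context array_model
begin

text \<open>\<open>sol (int n) n\<close> is the value at time 0 of the recursion started at time -n:
  stationarity gives its law, and an earlier start gives a larger value.\<close>

lemma coupling: "monotone_coupling M (sol 0) (\<lambda>n. sol (int n) n)"
proof unfold_locales
  show "sol (int n) n \<omega> \<le> sol (int (Suc n)) (Suc n) \<omega>" if "\<omega> \<in> space M" for n \<omega>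
    using sol_shift_mono[OF that, of "int n" n] by (simp add: add.commute)
  show "distr M borel (sol (int n) n) = distr M borel (sol 0 n)" for n by (rule sol_distr)
qed simp_all

lemma sol_rec:
  "sol 0 n \<omega> = (\<Sum>j<n. At (int n) (Suc j) \<omega> * sol 0 (n - Suc j) \<omega>) + Bt (int n) \<omega>"
  by (simp add: sol_def rec_sol.simps[of _ _ n])

lemma moments:
  assumes \<theta>: "0 < \<theta>" and A_nonneg: "\<And>j \<omega>. 1 \<le> j \<Longrightarrow> \<omega> \<in> space M0 \<Longrightarrow> 0 \<le> A j \<omega>"
    and B_nonneg: "\<And>\<omega>. \<omega> \<in> space M0 \<Longrightarrow> 0 \<le> B \<omega>"
    and B_nontrivial: "measure M0 {\<omega> \<in> space M0. B \<omega> = 0} < 1"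
  shows "moment_recursion M (\<lambda>n j \<omega>. At (int n) (Suc j) \<omega> * sol 0 (n - Suc j) \<omega>) (\<lambda>n. Bt (int n)) (sol 0) \<theta>
    (\<lambda>j. moment M0 (\<lambda>\<omega>. ennreal (A (Suc j) \<omega>)) \<theta>) (moment M0 (\<lambda>\<omega>. ennreal (B \<omega>)) \<theta>)
    (\<lambda>n. moment M (\<lambda>\<omega>. ennreal (sol 0 n \<omega>)) \<theta>)"
proof -
  interpret monotone_coupling M "sol 0" "\<lambda>n. sol (int n) n" by (rule coupling)
  show ?thesis
  proof unfold_locales
    show "(\<lambda>\<omega>. At (int n) (Suc j) \<omega> * sol 0 (n - Suc j) \<omega>) \<in> borel_measurable M" for n j
      by (intro borel_measurable_times measurable_At measurable_sol) simp
    show "(\<integral>\<^sup>+\<omega>. ennreal (Bt (int n) \<omega> powr \<theta>) \<partial>M) = moment M0 (\<lambda>\<omega>. ennreal (B \<omega>)) \<theta>" for n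
      using nn_integral_eq_if_distr_eq[OF Bt_distr, where h = "\<lambda>x. ennreal (x powr \<theta>)"]
      by (simp add: moment_nonneg_eq B_nonneg)
    show "incseq (\<lambda>n. moment M (\<lambda>\<omega>. ennreal (sol 0 n \<omega>)) \<theta>)" by (rule moment_mono[OF \<theta>])
    show "0 < moment M0 (\<lambda>\<omega>. ennreal (B \<omega>)) \<theta>"
      using B_nonneg B_nontrivial by (intro M0.moment_pos) auto
  qed (simp_all add: At_nonneg Bt_nonneg sol_nonneg sol_rec[symmetric] product_moment
        moment_nonneg_eq A_nonneg \<theta>)
qed

end

theorem theorem1p2:
  fixes M0 :: "'a measure" and A :: "nat \<Rightarrow> 'a \<Rightarrow> real" and B :: "'a \<Rightarrow> real"
    and M :: "'b measure" and At :: "int \<Rightarrow> nat \<Rightarrow> 'b \<Rightarrow> real" and Bt :: "int \<Rightarrow> 'b \<Rightarrow> real"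
    and X :: "int \<Rightarrow> 'b \<Rightarrow> real"
  assumes "prob_space M0"
    and "\<And>j. j \<ge> 1 \<Longrightarrow> A j \<in> borel_measurable M0"
    and "B \<in> borel_measurable M0"
    and "\<And>j \<omega>. j \<ge> 1 \<Longrightarrow> \<omega> \<in> space M0 \<Longrightarrow> A j \<omega> \<ge> 0"
    and "\<And>\<omega>. \<omega> \<in> space M0 \<Longrightarrow> B \<omega> \<ge> 0"
    and "measure M0 {\<omega> \<in> space M0. B \<omega> = 0} < 1"
    and "prob_space M"
    and "\<And>t j. j \<ge> 1 \<Longrightarrow> At t j \<in> borel_measurable M"
    and "\<And>t. Bt t \<in> borel_measurable M"
    and "\<And>t j \<omega>. j \<ge> 1 \<Longrightarrow> \<omega> \<in> space M \<Longrightarrow> At t j \<omega> \<ge> 0"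
    and "\<And>t \<omega>. \<omega> \<in> space M \<Longrightarrow> Bt t \<omega> \<ge> 0"
    and "cond_A1 M0 A B M At Bt \<or> cond_A2 M0 A B M At Bt"
    and "\<And>t \<omega>. t < 0 \<Longrightarrow> \<omega> \<in> space M \<Longrightarrow> X t \<omega> = 0"
    and "\<And>t \<omega>. t \<ge> 0 \<Longrightarrow> \<omega> \<in> space M \<Longrightarrow>
           X t \<omega> = (\<Sum>j. At t (Suc j) \<omega> * X (t - int (Suc j)) \<omega>) + Bt t \<omega>"
  shows "(\<exists>(N :: ennreal measure) Xlim. prob_space N \<and> Xlim \<in> borel_measurable N \<and>
            converges_in_law M (\<lambda>n \<omega>. ennreal (X (int n) \<omega>)) N Xlim)
       \<and> (\<forall>(N :: 'c measure) (Xlim :: 'c \<Rightarrow> ennreal).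
            prob_space N \<longrightarrow> Xlim \<in> borel_measurable N \<longrightarrow>
            converges_in_law M (\<lambda>n \<omega>. ennreal (X (int n) \<omega>)) N Xlim \<longrightarrow>
            (\<forall>\<theta>::real. 0 < \<theta> \<and> \<theta> \<le> 1 \<and> phi1 M0 A \<theta> < 0 \<and> moment M0 (\<lambda>\<omega>. ennreal (B \<omega>)) \<theta> < \<infinity>
               \<longrightarrow> moment N Xlim \<theta> < \<infinity>) \<and>
            (\<forall>\<theta>::real. \<theta> \<ge> 1 \<and> (phi1 M0 A \<theta> \<ge> 0 \<or> moment M0 (\<lambda>\<omega>. ennreal (B \<omega>)) \<theta> = \<infinity>)
               \<longrightarrow> moment N Xlim \<theta> = \<infinity>) \<and>
            (\<forall>\<theta>::real. \<theta> \<ge> 1 \<and> phi1_tilde M0 A \<theta> < 0 \<and> moment M0 (\<lambda>\<omega>. ennreal (B \<omega>)) \<theta> < \<infinity>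
               \<longrightarrow> moment N Xlim \<theta> < \<infinity>) \<and>
            (\<forall>\<theta>::real. 0 < \<theta> \<and> \<theta> < 1 \<and> (phi1_tilde M0 A \<theta> \<ge> 0 \<or> moment M0 (\<lambda>\<omega>. ennreal (B \<omega>)) \<theta> = \<infinity>)
               \<longrightarrow> moment N Xlim \<theta> = \<infinity>))"
proof -
  interpret array_model M0 A B M At Bt
    using assms by (intro array_model.intro array_model_axioms.intro)
  interpret monotone_coupling M "sol 0" "\<lambda>n. sol (int n) n" by (rule coupling)
  have X_eq: "X (int n) \<omega> = sol 0 n \<omega>" if \<omega>: "\<omega> \<in> space M" for n \<omega>
  proof (induction n rule: less_induct)
    case (less n)
    have "X (int n) \<omega> = (\<Sum>j. At (int n) (Suc j) \<omega> * X (int n - int (Suc j)) \<omega>) + Bt (int n) \<omega>"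
      using \<omega> by (intro assms(14)) auto
    \<comment> \<open>The terms with j \<ge> n involve negative times, where \<open>X\<close>
      vanishes, so the series is a finite sum.\<close>
    also have "(\<Sum>j. At (int n) (Suc j) \<omega> * X (int n - int (Suc j)) \<omega>)
        = (\<Sum>j<n. At (int n) (Suc j) \<omega> * X (int n - int (Suc j)) \<omega>)"
      using \<omega> by (intro suminf_finite) (auto simp: assms(13))
    also have "\<dots> = (\<Sum>j<n. At (int n) (Suc j) \<omega> * sol 0 (n - Suc j) \<omega>)"
    proof (intro sum.cong refl)
      fix j assume j: "j \<in> {..<n}"
      then have "int n - int (Suc j) = int (n - Suc j)" by auto
      with j show "At (int n) (Suc j) \<omega> * X (int n - int (Suc j)) \<omega>
          = At (int n) (Suc j) \<omega> * sol 0 (n - Suc j) \<omega>"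
        by (simp only: less lessThan_iff)
    qed
    finally show ?case by (simp add: sol_rec[symmetric])
  qed
  have law: "converges_in_law M (\<lambda>n \<omega>. ennreal (X (int n) \<omega>)) N Z
      \<longleftrightarrow> converges_in_law M (\<lambda>n \<omega>. ennreal (sol 0 n \<omega>)) N Z" for N :: "'d measure" and Z
    unfolding converges_in_law_def by (simp add: X_eq cong: Bochner_Integration.integral_cong)
  have "\<exists>(N :: ennreal measure) Z. prob_space N \<and> Z \<in> borel_measurable N \<and>
      converges_in_law M (\<lambda>n \<omega>. ennreal (X (int n) \<omega>)) N Z"
    unfolding law
  proof (intro exI conjI)
    show "prob_space (distr M borel (\<lambda>\<omega>. SUP n. ennreal (sol (int n) n \<omega>)))"
      by (rule M.prob_space_distr) measurable
    show "(\<lambda>x. x) \<in> borel_measurable (distr M borel (\<lambda>\<omega>. SUP n. ennreal (sol (int n) n \<omega>)))"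
      by simp
  qed (rule converges_to_supremum)
  moreover have "(0 < \<theta> \<and> \<theta> \<le> 1 \<and> phi1 M0 A \<theta> < 0 \<and> moment M0 (\<lambda>\<omega>. ennreal (B \<omega>)) \<theta> < \<infinity>
        \<longrightarrow> moment N Z \<theta> < \<infinity>)
      \<and> (\<theta> \<ge> 1 \<and> (phi1 M0 A \<theta> \<ge> 0 \<or> moment M0 (\<lambda>\<omega>. ennreal (B \<omega>)) \<theta> = \<infinity>)
        \<longrightarrow> moment N Z \<theta> = \<infinity>)
      \<and> (\<theta> \<ge> 1 \<and> phi1_tilde M0 A \<theta> < 0 \<and> moment M0 (\<lambda>\<omega>. ennreal (B \<omega>)) \<theta> < \<infinity>
        \<longrightarrow> moment N Z \<theta> < \<infinity>)
      \<and> (0 < \<theta> \<and> \<theta> < 1 \<and> (phi1_tilde M0 A \<theta> \<ge> 0 \<or> moment M0 (\<lambda>\<omega>. ennreal (B \<omega>)) \<theta> = \<infinity>)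
        \<longrightarrow> moment N Z \<theta> = \<infinity>)"
    if N: "prob_space N" and Z: "Z \<in> borel_measurable N"
      and lim: "converges_in_law M (\<lambda>n \<omega>. ennreal (X (int n) \<omega>)) N Z"
    for N :: "'c measure" and Z :: "'c \<Rightarrow> ennreal" and \<theta> :: real
  \<comment> \<open>Each of the four premises forces \<theta> > 0, so the other case is
    vacuous.\<close>
  proof (cases "0 < \<theta>")
    case True
    interpret R: moment_recursion M "\<lambda>n j \<omega>. At (int n) (Suc j) \<omega> * sol 0 (n - Suc j) \<omega>"
      "\<lambda>n. Bt (int n)" "sol 0" \<theta> "\<lambda>j. moment M0 (\<lambda>\<omega>. ennreal (A (Suc j) \<omega>)) \<theta>"
      "moment M0 (\<lambda>\<omega>. ennreal (B \<omega>)) \<theta>" "\<lambda>n. moment M (\<lambda>\<omega>. ennreal (sol 0 n \<omega>)) \<theta>"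
      using True assms(4-6) by (rule moments)
    show ?thesis
      unfolding moment_limit[OF N Z True lim[unfolded law]] phi1_def phi1_tilde_def
        ennreal_ln_neg_iff ennreal_ln_nonneg_iff
      using R.SUP_m_finite_le_1 R.SUP_m_infinite_ge_1 R.SUP_m_finite_ge_1 R.SUP_m_infinite_less_1
      by blast
  qed auto
  ultimately show ?thesis by blast
qed

end
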